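(* Let $V:\mathcal{M}^+(\mathbb{R}^d)\to\mathcal{M}^+(\mathbb{R}^d\times\mathbb{R}^d)$, $s:\mathcal{M}^+(\mathbb{R}^d)\to\mathcal{M}^+(\mathbb{R}^d)$ and $c:\mathbb{R}^d\times\mathcal{M}^+(\mathbb{R}^d)\to\mathbb{R}$ satisfy conditions (V), (S), (C) below, and let $\mu_0\in\mathcal{M}^+(\mathbb{R}^d)$ be compactly supported. Then there exists a solution $\mu_\bullet$ of $$\dot\mu_t = V[\mu_t]\oplus c(\cdot,\mu_t)\,\mu_t\oplus s[\mu_t]$$ with initial condition $\mu_0$ in the sense defined below. This solution is Lipschitz continuous with respect to time (as a map $[0,T]\to(\mathcal{M}^+(\mathbb{R}^d),\|\cdot\|_{BL^*})$). Conditions: (V) For all $\mu\in\mathcal{M}^+(\mathbb{R}^d)$, $\pi_1^{\#}V[\mu]=\mu$, where $\pi_1(x,v)=x$; moreover (V1) there is $C_S>0$ with $\sup_{(x,v)\in\operatorname{supp}V[\mu]}|v|\le C_S\bigl(1+\sup_{(x,v)\in\operatorname{supp}V[\mu]}|x|\bigr)$ for all $\mu$; (V2) for every $R>0$ there is $C_F(R)$ such that $\|V[\mu]-V[\nu]\|_{BL^*}\le C_F(R)\|\mu-\nu\|_{BL^*}$ whenever $\mu,\nu$ are supported in $B(0,R)$. (S) (S1) there is $L$ with $\|s[\mu]-s[\nu]\|_{BL^*}\le L\|\mu-\nu\|_{BL^*}$ for all $\mu,\nu\in\mathcal{M}^+(\mathbb{R}^d)$; (S2) there is $R$ with $\operatorname{supp}(s[\mu])\subseteq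 B(0,R)$ for all $\mu$. (C) (C1) there is $C_b>0$ with $|c(x,\mu)|\le C_b$ for all $x,\mu$; (C2) there is $C_L>0$ with $|c(x,\mu)-c(y,\nu)|\le C_L\bigl(|x-y|+\|\mu-\nu\|_{BL^*}\bigr)$ for all $x,y,\mu,\nu$.
   Context: $\mathcal{M}^+(\mathbb{R}^k)$ denotes the finite nonnegative Borel (Radon) measures on $\mathbb{R}^k$. For $f:\mathbb{R}^k\to\mathbb{R}$ let $\|f\|_{BL}=\max(\sup|f|,\ \operatorname{Lip}(f))$ where $\operatorname{Lip}(f)=\sup_{x\ne y}|f(x)-f(y)|/|x-y|$. The flat norm of a signed finite measure $\mu$ on $\mathbb{R}^k$ is $\|\mu\|_{BL^*}=\sup\{\int\psi\,d\mu:\ \|\psi\|_{BL}\le 1\}$ ($k=d$ or $k=2d$). A solution on $[0,T]$ with initial condition $\mu_0$ is a continuous curve $\mu_\bullet:[0,T]\to(\mathcal{M}^+(\mathbb{R}^d),\|\cdot\|_{BL^*})$ such that for all $f\in C_c^\infty(\mathbb{R}^d)$ and all $t\in[0,T]$, $$\int f\,d\mu_t-\int f\,d\mu_0=\int_0^t\!\!\int_{\mathbb{R}^d\times\mathbb{R}^d}\nabla f(x)\cdot v\,dV[\mu_r](x,v)\,dr+\int_0^t\!\!\int f(x)c(x,\mu_r)\,d\mu_r(x)\,dr+\int_0^t\!\!\int f\,ds[\mu_r]\,dr.$$ *)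

theory Defs
  imports "HOL-Analysis.Analysis"
begin

definition fin_meas :: "'b::metric_space measure \<Rightarrow> bool" where
  "fin_meas M \<longleftrightarrow> sets M = sets borel \<and> emeasure M UNIV < \<infinity>"

definition supp :: "'b::metric_space measure \<Rightarrow> 'b set" where
  "supp M = {x. \<forall>e>0. emeasure M (ball x e) > 0}"

definition BL1 :: "('b::metric_space \<Rightarrow> real) \<Rightarrow> bool" where
  "BL1 f \<longleftrightarrow> (\<forall>x. \<bar>f x\<bar> \<le> 1) \<and> (\<forall>x y. \<bar>f x - f y\<bar> \<le> dist x y)"

definition flat :: "'b::metric_space measure \<Rightarrow> 'b measure \<Rightarrow> real" where
  "flat M N = (SUP \<psi>\<in>{\<psi>. BL1 \<psi>}. (\<integral>x. \<psi> x \<partial>M) - (\<integral>x. \<psi> x \<partial>N))"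

fun Ck :: "nat \<Rightarrow> ('a::euclidean_space \<Rightarrow> real) \<Rightarrow> bool" where
  "Ck 0 f = continuous_on UNIV f"
| "Ck (Suc k) f = (f differentiable_on UNIV \<and> continuous_on UNIV f \<and>
      (\<forall>i\<in>Basis. Ck k (\<lambda>x. frechet_derivative f (at x) i)))"

definition Cc_inf :: "('a::euclidean_space \<Rightarrow> real) \<Rightarrow> bool" where
  "Cc_inf f \<longleftrightarrow> (\<forall>k. Ck k f) \<and> compact (closure {x. f x \<noteq> 0})"

end

theory Submission
  imports Defs "HOL-Complex_Analysis.Great_Picard"
begin

text \<open>
  Solutions are limits of the explicit Euler scheme
  \<open>\<integral> f d\<mu>' = \<integral> (1 + h c(x, \<mu>)) f(x + h v) dV[\<mu>](x, v) + h \<integral> f ds[\<mu>]\<close>.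
  By the sublinear growth in (V1), the uniform support of the source and the bound on \<open>c\<close>, the
  iterates up to time \<open>T\<close> stay in a fixed ball with bounded mass, and one step moves the measure by
  \<open>O(h)\<close> in the flat norm. Bounded Lipschitz functions on a compact set are totally bounded for the
  supremum norm, so a diagonal subsequence converges in the flat norm at every time; the limits,
  a priori positive functionals on bounded Lipschitz functions, are measures by a Riesz
  representation theorem.

  The right-hand side \<open>F\<close> of the weak formulation is flat-Lipschitz on measures of bounded support and
  mass, and one Euler step changes \<open>\<integral> f d\<mu>\<close> by \<open>h F(\<mu>)\<close> up to \<open>O(h^2)\<close>. Summing the steps and letting
  \<open>h\<close> tend to 0 gives \<open>\<bar>\<phi>(t) - \<phi>(r) - (t - r) F(\<mu>\<^sub>r)\<bar> \<le> C (t - r)^2\<close> for \<open>\<phi>(t) = \<integral> f d\<mu>\<^sub>t\<close>; hence \<open>\<phi>\<close> has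
  the continuous derivative \<open>F(\<mu>\<^sub>t)\<close>, and the weak formulation is the fundamental theorem of calculus.
\<close>

subsection \<open>Bounded Lipschitz functions and the flat metric\<close>

text \<open>Bounded Lipschitz test functions are too rough for a stability estimate of the scheme.
  For such f the increment f(x + h v) - f(x) is O(h) in the supremum norm, but its Lipschitz
  constant need not be small, so (V2) controls the effect of one step on the flat distance of two
  measures only up to a fixed factor, not up to 1 + O(h). Iterates for different step sizes are
  therefore never compared: compactness supplies a limit, without uniqueness. For smooth f the
  gradient is itself Lipschitz, and this is where (V2) becomes usable: \<open>drift\<close> is
  flat-Lipschitz on measures of bounded support. Positivity is the second constraint. It asks for 1
  + h c to be nonnegative, whence the restriction \<open>h * Cb \<le> 1\<close>, and it lets one
  Riesz theorem serve twice: each Euler step is a positive functional before it is a measure, and so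
  is each limit. No push-forward, density or sum of measures has to be assembled.\<close>

definition bl :: "real \<Rightarrow> ('b::metric_space \<Rightarrow> real) \<Rightarrow> bool" where
  "bl A f \<longleftrightarrow> (\<forall>x. \<bar>f x\<bar> \<le> A) \<and> (\<forall>x y. \<bar>f x - f y\<bar> \<le> A * dist x y)"

text \<open>One constant bounds both the supremum and the Lipschitz constant, so \<open>bl A\<close>
  is the closed ball of radius \<open>A\<close> in the BL norm.\<close>

lemma BL1_eq_bl: "BL1 = bl 1"
  by (auto simp: BL1_def bl_def fun_eq_iff)

lemma bl_bound: "bl A f \<Longrightarrow> \<bar>f x\<bar> \<le> A"
  by (simp add: bl_def)

lemma bl_lip: "bl A f \<Longrightarrow> \<bar>f x - f y\<bar> \<le> A * dist x y"
  by (simp add: bl_def)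

lemma bl_nonneg: "bl A f \<Longrightarrow> 0 \<le> A"
  using bl_bound[of A f undefined] by linarith

lemma bl_mono: "bl A f \<Longrightarrow> A \<le> B \<Longrightarrow> bl B f"
  unfolding bl_def by (meson dual_order.trans mult_right_mono zero_le_dist)

lemma bl_const: "bl \<bar>a\<bar> (\<lambda>_. a)"
  by (simp add: bl_def)

lemma bl_add:
  assumes "bl A f" "bl B g" shows "bl (A + B) (\<lambda>x. f x + g x)"
  unfolding bl_def
proof (intro conjI allI)
  fix x y
  show "\<bar>f x + g x\<bar> \<le> A + B"
    using bl_bound[OF assms(1), of x] bl_bound[OF assms(2), of x] by linarith
  show "\<bar>f x + g x - (f y + g y)\<bar> \<le> (A + B) * dist x y"
    using bl_lip[OF assms(1), of x y] bl_lip[OF assms(2), of x y]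
    by (simp add: distrib_right)
qed

lemma bl_cmult:
  assumes "bl A f" shows "bl (\<bar>a\<bar> * A) (\<lambda>x. a * f x)"
  unfolding bl_def
proof (intro conjI allI)
  fix x y
  show "\<bar>a * f x\<bar> \<le> \<bar>a\<bar> * A"
    using bl_bound[OF assms, of x] by (simp add: abs_mult mult_left_mono)
  have "\<bar>a * f x - a * f y\<bar> = \<bar>a\<bar> * \<bar>f x - f y\<bar>"
    by (simp add: abs_mult[symmetric] right_diff_distrib)
  also have "\<dots> \<le> \<bar>a\<bar> * (A * dist x y)"
    using bl_lip[OF assms, of x y] by (simp add: mult_left_mono)
  finally show "\<bar>a * f x - a * f y\<bar> \<le> \<bar>a\<bar> * A * dist x y"
    by (simp add: mult.assoc)
qed

lemma bl_uminus: "bl A f \<Longrightarrow> bl A (\<lambda>x. - f x)"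
  using bl_cmult[of A f "-1"] by simp

lemma bl_diff: "bl A f \<Longrightarrow> bl B g \<Longrightarrow> bl (A + B) (\<lambda>x. f x - g x)"
  using bl_add[of A f B "\<lambda>x. - g x"] bl_uminus[of B g] by simp

text \<open>The supremum needs \<open>A * B\<close>; the Lipschitz constant needs twice that, by the
  product rule.\<close>

lemma bl_mult:
  assumes "bl A f" "bl B g" shows "bl (2 * A * B) (\<lambda>x. f x * g x)"
  unfolding bl_def
proof (intro conjI allI)
  fix x y
  have AB: "0 \<le> A" "0 \<le> B" using assms bl_nonneg by blast+
  have *: "\<bar>f x * g x\<bar> \<le> A * B"
    unfolding abs_mult using assms AB by (intro mult_mono) (auto simp: bl_bound)
  show "\<bar>f x * g x\<bar> \<le> 2 * A * B"
    using * AB mult_nonneg_nonneg[of A B] by linarith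
  have "f x * g x - f y * g y = f x * (g x - g y) + (f x - f y) * g y"
    by (simp add: algebra_simps)
  then have "\<bar>f x * g x - f y * g y\<bar> \<le> \<bar>f x\<bar> * \<bar>g x - g y\<bar> + \<bar>f x - f y\<bar> * \<bar>g y\<bar>"
    by (metis abs_mult abs_triangle_ineq)
  also have "\<dots> \<le> A * (B * dist x y) + (A * dist x y) * B"
    using assms AB by (intro add_mono mult_mono) (auto simp: bl_bound bl_lip)
  finally show "\<bar>f x * g x - f y * g y\<bar> \<le> 2 * A * B * dist x y"
    by (simp add: algebra_simps)
qed

lemma bl_max:
  assumes "bl A f" "bl B g" shows "bl (A + B) (\<lambda>x. max (f x) (g x))"
  unfolding bl_def
proof (intro conjI allI)
  fix x y
  show "\<bar>max (f x) (g x)\<bar> \<le> A + B"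
    using bl_bound[OF assms(1), of x] bl_bound[OF assms(2), of x]
    by (simp add: max_def abs_if split: if_splits)
  show "\<bar>max (f x) (g x) - max (f y) (g y)\<bar> \<le> (A + B) * dist x y"
    using bl_lip[OF assms(1), of x y] bl_lip[OF assms(2), of x y]
    unfolding distrib_right by (simp add: max_def abs_if split: if_splits)
qed

lemma bl_min:
  assumes "bl A f" "bl B g" shows "bl (A + B) (\<lambda>x. min (f x) (g x))"
proof -
  have "(\<lambda>x. min (f x) (g x)) = (\<lambda>x. - max (- f x) (- g x))"
    by (auto simp: fun_eq_iff min_def max_def)
  then show ?thesis
    using bl_uminus[OF bl_max[OF bl_uminus[OF assms(1)] bl_uminus[OF assms(2)]]] by simp
qed

lemma bl_continuous_on: "bl A f \<Longrightarrow> continuous_on S f"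
  by (rule lipschitz_on_continuous_on[of A])
     (auto simp: bl_nonneg lipschitz_on_def dist_real_def bl_lip)

section \<open>Finite measures, the flat metric and supports\<close>

lemma fin_measD:
  assumes "fin_meas M"
  shows "finite_measure M" "space M = UNIV" "sets M = sets borel"
    "measurable M N = measurable borel N"
proof -
  show *: "sets M = sets borel" using assms by (simp add: fin_meas_def)
  show "space M = UNIV" using sets_eq_imp_space_eq[OF *] by simp
  then show "finite_measure M"
    using assms by (intro finite_measureI) (auto simp: fin_meas_def)
  show "measurable M N = measurable borel N"
    using * by (rule measurable_cong_sets) simp
qed

lemma integrable_fin_meas:
  fixes f :: "'b::metric_space \<Rightarrow> real"
  assumes "fin_meas M" "AE x in M. \<bar>f x\<bar> \<le> A" "f \<in> borel_measurable borel"
  shows "integrable M f"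
  using finite_measure.integrable_const_bound[OF fin_measD(1)[OF assms(1)], of f A] assms
  by (simp add: fin_measD(4))

lemma bl_measurable: "bl A f \<Longrightarrow> f \<in> borel_measurable borel"
  by (intro borel_measurable_continuous_onI bl_continuous_on)

lemma bl_integrable: "fin_meas M \<Longrightarrow> bl A f \<Longrightarrow> integrable M f"
  by (rule integrable_fin_meas[where A = A]) (auto simp: bl_bound bl_measurable)

lemma integral_abs_le_mass:
  fixes f :: "'b::metric_space \<Rightarrow> real"
  assumes "fin_meas M" "AE x in M. \<bar>f x\<bar> \<le> A" "0 \<le> A"
  shows "\<bar>\<integral>x. f x \<partial>M\<bar> \<le> A * measure M UNIV"
proof (cases "integrable M f")
  case True
  have "\<bar>\<integral>x. f x \<partial>M\<bar> \<le> (\<integral>x. \<bar>f x\<bar> \<partial>M)" by (rule integral_abs_bound)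
  also have "\<dots> \<le> (\<integral>x. A \<partial>M)"
    using True assms fin_measD(1)[OF assms(1)]
    by (intro integral_mono_AE) (auto simp: finite_measure.integrable_const)
  finally show ?thesis using assms by (simp add: fin_measD(2) mult.commute)
next
  case False
  then show ?thesis using assms by (simp add: not_integrable_integral_eq)
qed

lemma bl_integral_abs_le:
  assumes "fin_meas M" "bl A f" shows "\<bar>\<integral>x. f x \<partial>M\<bar> \<le> A * measure M UNIV"
  using assms by (intro integral_abs_le_mass) (auto simp: bl_bound bl_nonneg)

lemma flat_ge:
  assumes "fin_meas M" "fin_meas N" "bl 1 f"
  shows "(\<integral>x. f x \<partial>M) - (\<integral>x. f x \<partial>N) \<le> flat M N"
  unfolding flat_def BL1_eq_bl
proof (rule cSUP_upper)
  show "bdd_above ((\<lambda>\<psi>. (\<integral>x. \<psi> x \<partial>M) - (\<integral>x. \<psi> x \<partial>N)) ` {\<psi>. bl 1 \<psi>})"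
  proof (intro bdd_aboveI2)
    fix \<psi> :: "'a \<Rightarrow> real" assume "\<psi> \<in> {\<psi>. bl 1 \<psi>}"
    then show "(\<integral>x. \<psi> x \<partial>M) - (\<integral>x. \<psi> x \<partial>N) \<le> measure M UNIV + measure N UNIV"
      using bl_integral_abs_le[OF assms(1), of 1 \<psi>] bl_integral_abs_le[OF assms(2), of 1 \<psi>]
      by (auto simp: abs_le_iff)
  qed
qed (use assms in simp)

lemma flat_le:
  assumes "\<And>f. bl 1 f \<Longrightarrow> (\<integral>x. f x \<partial>M) - (\<integral>x. f x \<partial>N) \<le> B"
  shows "flat M N \<le> B"
  unfolding flat_def BL1_eq_bl
  using bl_mono[OF bl_const[of 0], of 1] by (intro cSUP_least) (auto intro: assms)

lemma flat_nonneg: "fin_meas M \<Longrightarrow> fin_meas N \<Longrightarrow> 0 \<le> flat M N"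
  using flat_ge[of M N "\<lambda>_. 0"] bl_mono[OF bl_const[of 0], of 1] by simp

lemma flat_sym:
  assumes "fin_meas M" "fin_meas N" shows "flat M N = flat N M"
proof -
  have "flat M N \<le> flat N M" if "fin_meas M" "fin_meas N" for M N :: "'a measure"
  proof (rule flat_le)
    fix f :: "'a \<Rightarrow> real" assume "bl 1 f"
    then show "(\<integral>x. f x \<partial>M) - (\<integral>x. f x \<partial>N) \<le> flat N M"
      using flat_ge[OF that(2,1) bl_uminus] by simp
  qed
  then show ?thesis using assms by (intro antisym)
qed

lemma flat_triangle:
  assumes "fin_meas M" "fin_meas N" "fin_meas P" shows "flat M P \<le> flat M N + flat N P"
proof (rule flat_le)
  fix f :: "'a \<Rightarrow> real" assume "bl 1 f"
  then show "(\<integral>x. f x \<partial>M) - (\<integral>x. f x \<partial>P) \<le> flat M N + flat N P"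
    using flat_ge[OF assms(1,2), of f] flat_ge[OF assms(2,3), of f] by linarith
qed

lemma flat_self: "flat M M \<le> 0"
  by (rule flat_le) simp

text \<open>Scaling by \<open>1 / A\<close> puts \<open>f\<close> into the unit ball, and symmetry
  of \<open>flat\<close> gives both signs. This is the passage from flat bounds to integrals of
  arbitrary bounded Lipschitz functions.\<close>

lemma bl_integral_diff_le:
  assumes "fin_meas M" "fin_meas N" "bl A f"
  shows "\<bar>(\<integral>x. f x \<partial>M) - (\<integral>x. f x \<partial>N)\<bar> \<le> A * flat M N"
proof (cases "A = 0")
  case True
  then have "f = (\<lambda>_. 0)" using assms(3) by (auto simp: bl_def)
  then show ?thesis using True by simp
next
  case False
  then have A: "A > 0" using bl_nonneg[OF assms(3)] by simp
  have *: "bl 1 (\<lambda>x. (1 / A) * f x)"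
    using bl_cmult[OF assms(3), of "1 / A"] A by simp
  have "((\<integral>x. f x \<partial>M) - (\<integral>x. f x \<partial>N)) / A \<le> flat M N"
    using flat_ge[OF assms(1,2) *] A by (simp add: diff_divide_distrib)
  moreover have "((\<integral>x. f x \<partial>N) - (\<integral>x. f x \<partial>M)) / A \<le> flat M N"
    using flat_ge[OF assms(2,1) *] A flat_sym[OF assms(1,2)] by (simp add: diff_divide_distrib)
  ultimately show ?thesis using A by (simp add: abs_le_iff pos_divide_le_eq mult.commute)
qed

lemma mass_diff_le_flat:
  assumes "fin_meas M" "fin_meas N"
  shows "\<bar>measure M UNIV - measure N UNIV\<bar> \<le> flat M N"
  using bl_integral_diff_le[OF assms, of 1 "\<lambda>_. 1"] bl_const[of 1] assms
  by (simp add: fin_measD(2))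

lemma flat_le_mass:
  assumes "fin_meas M" "fin_meas N"
  shows "flat M N \<le> measure M UNIV + measure N UNIV"
proof (rule flat_le)
  fix f :: "'a \<Rightarrow> real" assume "bl 1 f"
  then show "(\<integral>x. f x \<partial>M) - (\<integral>x. f x \<partial>N) \<le> measure M UNIV + measure N UNIV"
    using bl_integral_abs_le[OF assms(1), of 1 f] bl_integral_abs_le[OF assms(2), of 1 f]
    by (auto simp: abs_le_iff)
qed

text \<open>Links (V1) and (S2), which speak of topological supports, to the almost-everywhere form
  in which all estimates are made. The complement of the support is a union of null balls, and by
  Lindelof countably many of them suffice.\<close>

lemma supp_subset_iff:
  fixes M :: "'b::euclidean_space measure"
  assumes M: "fin_meas M" and K: "closed K"
  shows "supp M \<subseteq> K \<longleftrightarrow> (AE x in M. x \<in> K)"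
proof
  assume AE: "AE x in M. x \<in> K"
  show "supp M \<subseteq> K"
  proof
    fix x assume x: "x \<in> supp M"
    show "x \<in> K"
    proof (rule ccontr)
      assume "x \<notin> K"
      then obtain e where e: "e > 0" "ball x e \<subseteq> - K"
        using K open_contains_ball[of "- K"] by (auto simp: closed_def)
      have "AE y in M. y \<notin> ball x e" using AE by (rule AE_mp) (rule AE_I2, use e(2) in auto)
      then have "emeasure M (ball x e) = 0"
        by (subst (asm) AE_iff_measurable[where N = "ball x e"])
           (auto simp: fin_measD[OF M])
      then show False using x e(1) by (auto simp: supp_def)
    qed
  qed
next
  assume S: "supp M \<subseteq> K"
  define F where "F = {ball x e |x e. e > 0 \<and> emeasure M (ball x e) = 0}"
  obtain F' where F': "F' \<subseteq> F" "countable F'" "\<Union>F' = \<Union>F"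
    using Lindelof[of F] by (auto simp: F_def)
  have "AE x in M. \<forall>B\<in>F'. x \<notin> B"
    unfolding AE_ball_countable[OF F'(2)]
  proof
    fix B assume "B \<in> F'"
    then have "B \<in> F" using F' by auto
    then show "AE x in M. x \<notin> B"
      by (intro AE_I[where N = B]) (auto simp: F_def fin_measD[OF M])
  qed
  then show "AE x in M. x \<in> K"
  proof (rule AE_mp, intro AE_I2 impI)
    fix x assume "\<forall>B\<in>F'. x \<notin> B"
    then have "x \<notin> \<Union>F" using F'(3) by blast
    moreover have "x \<in> \<Union>F" if "x \<notin> supp M"
      using that by (force simp: supp_def F_def)
    ultimately show "x \<in> K" using S by blast
  qed
qed

subsection \<open>A Riesz representation theorem on bounded Lipschitz functions\<close>

lemma bl_sum:
  assumes "\<And>i. i \<in> I \<Longrightarrow> \<exists>A. bl A (f i)" shows "\<exists>A. bl A (\<lambda>x. \<Sum>i\<in>I. f i x)"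
proof (cases "finite I")
  case True
  then show ?thesis using assms
  proof (induction I rule: finite_induct)
    case empty
    show ?case using bl_const[of 0] by auto
  next
    case (insert i I)
    then show ?case using bl_add by fastforce
  qed
next
  case False
  then show ?thesis using bl_const[of 0] by auto
qed

text \<open>Minorants of the indicator of \<open>U\<close>. They vanish off \<open>U\<close> but
  need not have their support inside it; the cutoff in \<open>content_split\<close> creates a gap
  where one is needed.\<close>

definition bl_below :: "'b::metric_space set \<Rightarrow> ('b \<Rightarrow> real) set" where
  "bl_below U = {f. (\<exists>A. bl A f) \<and> (\<forall>x. 0 \<le> f x \<and> f x \<le> 1) \<and> (\<forall>x. x \<notin> U \<longrightarrow> f x = 0)}"

text \<open>Take \<open>n\<close> times the distance to the complement, capped at 1. At each point
  of \<open>U\<close> the value 1 is attained from some index on, not merely approached, and the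
  exhaustion argument for unions relies on this.\<close>

lemma bl_below_approx:
  fixes U :: "'b::metric_space set"
  assumes "open U"
  obtains g :: "nat \<Rightarrow> 'b \<Rightarrow> real" where
    "\<And>n. g n \<in> bl_below U" "\<And>m n x. m \<le> n \<Longrightarrow> g m x \<le> g n x"
    "\<And>x. x \<in> U \<Longrightarrow> \<exists>n. \<forall>m\<ge>n. g m x = 1"
proof (cases "U = UNIV")
  \<comment> \<open>\<open>infdist x {}\<close> is 0, so the distance formula would give the zero
    function here.\<close>
  case True
  show ?thesis
    by (rule that[of "\<lambda>n x. 1"]) (use True bl_const[of 1] in \<open>auto simp: bl_below_def\<close>)
next
  case False
  define g where "g n x = min 1 (real n * infdist x (- U))" for n x
  have ne: "- U \<noteq> {}" using False by auto
  show ?thesis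
  proof (rule that[of g])
    fix n
    have "bl (1 + real n) (g n)"
      unfolding bl_def
    proof (intro conjI allI)
      fix x y
      have "0 \<le> real n * infdist x (- U)" using infdist_nonneg[of x "- U"] by simp
      then show "\<bar>g n x\<bar> \<le> 1 + real n" unfolding g_def by linarith
      have "\<bar>g n x - g n y\<bar> \<le> \<bar>real n * infdist x (- U) - real n * infdist y (- U)\<bar>"
        by (auto simp: g_def min_def)
      also have "\<dots> = real n * \<bar>infdist x (- U) - infdist y (- U)\<bar>"
        by (simp add: abs_mult flip: right_diff_distrib)
      also have "\<dots> \<le> real n * dist x y"
        using infdist_triangle_abs by (intro mult_left_mono) auto
      finally show "\<bar>g n x - g n y\<bar> \<le> (1 + real n) * dist x y"
        by (simp add: algebra_simps add_increasing)
    qed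
    then show "g n \<in> bl_below U"
      unfolding bl_below_def using infdist_nonneg[of _ "- U"]
      by (auto simp: g_def)
  next
    fix m n :: nat and x assume "m \<le> n"
    then show "g m x \<le> g n x"
      unfolding g_def using infdist_nonneg[of x "- U"]
      by (intro min.mono mult_right_mono) auto
  next
    fix x assume "x \<in> U"
    then have d: "infdist x (- U) > 0"
      using in_closed_iff_infdist_zero[of "- U" x] assms ne infdist_nonneg[of x "- U"]
      by (auto simp: closed_def less_le)
    then obtain n where n: "1 < real n * infdist x (- U)"
      using reals_Archimedean3 by blast
    have "g m x = 1" if "m \<ge> n" for m
    proof -
      have "real n * infdist x (- U) \<le> real m * infdist x (- U)"
        using that d by (intro mult_right_mono) auto
      then show ?thesis using n by (simp add: g_def)
    qed
    then show "\<exists>n. \<forall>m\<ge>n. g m x = 1" by blast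
  qed
qed

text \<open>Continuity is not assumed; positivity provides it in the supremum norm over
  \<open>K\<close>. Testing the sign on \<open>K\<close> alone encodes that the functional is
  carried by \<open>K\<close>, and compactness of \<open>K\<close> is what Dini's argument
  needs.\<close>

locale bl_functional =
  fixes \<Lambda> :: "('b::metric_space \<Rightarrow> real) \<Rightarrow> real" and K :: "'b set"
  assumes add: "bl A f \<Longrightarrow> bl B g \<Longrightarrow> \<Lambda> (\<lambda>x. f x + g x) = \<Lambda> f + \<Lambda> g"
    and cmult: "bl A f \<Longrightarrow> \<Lambda> (\<lambda>x. a * f x) = a * \<Lambda> f"
    and nonneg: "bl A f \<Longrightarrow> (\<And>x. x \<in> K \<Longrightarrow> 0 \<le> f x) \<Longrightarrow> 0 \<le> \<Lambda> f"
    and K: "compact K"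
begin

lemma mono:
  assumes "bl A f" "bl B g" "\<And>x. x \<in> K \<Longrightarrow> f x \<le> g x" shows "\<Lambda> f \<le> \<Lambda> g"
proof -
  have "\<Lambda> (\<lambda>x. g x + - 1 * f x) = \<Lambda> g + - 1 * \<Lambda> f"
    using add[OF assms(2) bl_uminus[OF assms(1)]] cmult[OF assms(1), of "-1"] by simp
  moreover have "0 \<le> \<Lambda> (\<lambda>x. g x + - 1 * f x)"
    by (rule nonneg[of "B + A"]) (use assms bl_diff[OF assms(2,1)] in auto)
  ultimately show ?thesis by simp
qed

lemma const: "\<Lambda> (\<lambda>x. a) = a * \<Lambda> (\<lambda>x. 1)"
  using cmult[OF bl_const[of 1], of a] by simp

lemma one_nonneg: "0 \<le> \<Lambda> (\<lambda>x. 1)"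
  by (rule nonneg[OF bl_const]) simp

lemma sum:
  assumes "finite I" "\<And>i. i \<in> I \<Longrightarrow> \<exists>A. bl A (f i)"
  shows "\<Lambda> (\<lambda>x. \<Sum>i\<in>I. f i x) = (\<Sum>i\<in>I. \<Lambda> (f i))"
  using assms
proof (induction I rule: finite_induct)
  case empty
  show ?case using const[of 0] by simp
next
  case (insert i I)
  obtain A B where "bl A (f i)" "bl B (\<lambda>x. \<Sum>i\<in>I. f i x)"
    using insert bl_sum[of I f] by (meson insertCI)
  then show ?case using insert add by simp
qed

text \<open>The Riesz outer measure: open sets are measured from below by test functions
  (\<open>content\<close>), arbitrary sets from above by open sets (\<open>outer\<close>).
  Caratheodory's theorem then yields the measure.\<close>

definition content :: "'b set \<Rightarrow> ennreal" where
  "content U = (SUP f\<in>bl_below U. ennreal (\<Lambda> f))"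

definition outer :: "'b set \<Rightarrow> ennreal" where
  "outer X = (INF U\<in>{U. open U \<and> X \<subseteq> U}. content U)"

lemma content_ge: "f \<in> bl_below U \<Longrightarrow> ennreal (\<Lambda> f) \<le> content U"
  unfolding content_def by (rule SUP_upper)

lemma content_mono: "U \<subseteq> W \<Longrightarrow> content U \<le> content W"
  unfolding content_def by (rule SUP_subset_mono) (auto simp: bl_below_def)

lemma outer_open: "open U \<Longrightarrow> outer U = content U"
  unfolding outer_def by (intro antisym INF_lower INF_greatest) (auto intro: content_mono)

lemma outer_mono: "X \<subseteq> Y \<Longrightarrow> outer X \<le> outer Y"
  unfolding outer_def by (rule INF_superset_mono) auto

lemma content_UNIV: "content UNIV = ennreal (\<Lambda> (\<lambda>x. 1))"
proof (rule antisym)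
  show "content UNIV \<le> ennreal (\<Lambda> (\<lambda>x. 1))"
    unfolding content_def
    by (rule SUP_least) (auto simp: bl_below_def intro!: ennreal_leI mono[OF _ bl_const])
  show "ennreal (\<Lambda> (\<lambda>x. 1)) \<le> content UNIV"
    by (rule content_ge) (use bl_const[of 1] in \<open>auto simp: bl_below_def\<close>)
qed

lemma outer_le: "outer X \<le> ennreal (\<Lambda> (\<lambda>x. 1))"
  using outer_mono[of X UNIV] outer_open[of UNIV] content_UNIV by simp

lemma content_Compl_K: "content (- K) = 0"
proof -
  have "ennreal (\<Lambda> f) \<le> 0" if "f \<in> bl_below (- K)" for f
  proof -
    obtain A where A: "bl A f" "\<And>x. x \<in> K \<Longrightarrow> f x = 0"
      using \<open>f \<in> _\<close> by (auto simp: bl_below_def)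
    have "\<Lambda> f \<le> \<Lambda> (\<lambda>x. 0)" by (rule mono[OF A(1) bl_const]) (use A in simp)
    then show ?thesis using const[of 0] by (simp add: ennreal_neg)
  qed
  then show ?thesis unfolding content_def by (simp add: SUP_least le_zero_eq[symmetric] del: le_zero_eq)
qed

lemma content_empty: "content {} = 0"
  using content_mono[of "{}" "- K"] content_Compl_K by simp

text \<open>Dini's theorem, applied to the part of \<open>f\<close> not yet exhausted by the first \<open>n\<close> sets.\<close>

lemma content_UN_le:
  fixes U :: "nat \<Rightarrow> 'b set"
  assumes U: "\<And>i. open (U i)"
  shows "content (\<Union>i. U i) \<le> (\<Sum>i. content (U i))"
  unfolding content_def[of "\<Union>i. U i"]
proof (rule SUP_least)
  fix f assume f: "f \<in> bl_below (\<Union>i. U i)"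
  obtain A where A: "bl A f" using f by (auto simp: bl_below_def)
  have "\<exists>g :: nat \<Rightarrow> 'b \<Rightarrow> real. (\<forall>n. g n \<in> bl_below (U i)) \<and> (\<forall>m n x. m \<le> n \<longrightarrow> g m x \<le> g n x)
    \<and> (\<forall>x. x \<in> U i \<longrightarrow> (\<exists>n. \<forall>m\<ge>n. g m x = 1))" for i
    by (rule bl_below_approx[OF U[of i]]) blast
  then obtain g :: "nat \<Rightarrow> nat \<Rightarrow> 'b \<Rightarrow> real" where g: "\<And>i n. g i n \<in> bl_below (U i)"
      "\<And>i m n x. m \<le> n \<Longrightarrow> g i m x \<le> g i n x"
      "\<And>i x. x \<in> U i \<Longrightarrow> \<exists>n. \<forall>m\<ge>n. g i m x = 1"
    by metis
  have g0: "0 \<le> g i n x" for i n x using g(1)[of i n] by (auto simp: bl_below_def)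
  \<comment> \<open>The number of sets and the index of the approximants are both \<open>n\<close>,
    so that one decreasing sequence handles all sets at once.\<close>
  define h where "h n x = f x - (\<Sum>i<n. g i n x)" for n x
  have g_bl: "\<exists>B. bl B (g i n)" for i n using g(1)[of i n] by (auto simp: bl_below_def)
  have h_bl: "\<exists>B. bl B (h n)" for n
    unfolding h_def using bl_sum[of "{..<n}" "\<lambda>i. g i n"] g_bl bl_diff[OF A] by blast
  have h_anti: "h n x \<le> h m x" if "m \<le> n" for m n x
  proof -
    have "(\<Sum>i<m. g i m x) \<le> (\<Sum>i<m. g i n x)" using that by (intro sum_mono g(2))
    also have "\<dots> \<le> (\<Sum>i<n. g i n x)" using that g0 by (intro sum_mono2) auto
    finally show ?thesis by (simp add: h_def)
  qed
  have h_lim: "\<exists>n. h n x \<le> 0" for x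
  proof (cases "x \<in> (\<Union>i. U i)")
    case False
    then have "h 0 x \<le> 0" using f by (auto simp: h_def bl_below_def)
    then show ?thesis ..
  next
    case True
    then obtain i n where i: "\<forall>m\<ge>n. g i m x = 1" using g(3) by blast
    \<comment> \<open>From \<open>n\<close> on the approximant of \<open>U i\<close> is 1 at
      \<open>x\<close>; \<open>Suc i\<close> ensures that the index \<open>i\<close> occurs in the
      sum.\<close>
    define m where "m = max n (Suc i)"
    have "g i m x \<le> (\<Sum>i<m. g i m x)"
      using g0 by (intro member_le_sum) (auto simp: m_def)
    moreover have "g i m x = 1" using i by (auto simp: m_def)
    moreover have "f x \<le> 1" using f by (auto simp: bl_below_def)
    ultimately show ?thesis by (intro exI[of _ m]) (simp add: h_def)
  qed
  show "ennreal (\<Lambda> f) \<le> (\<Sum>i. content (U i))"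
  proof (rule ennreal_le_epsilon)
    fix e :: real assume e: "0 < e"
    \<comment> \<open>A uniform error \<open>d\<close> on \<open>K\<close> changes the functional by
      at most \<open>e\<close>; the 1 in the denominator admits
      \<open>\<Lambda> (\<lambda>x. 1) = 0\<close>.\<close>
    define d where "d = e / (1 + \<Lambda> (\<lambda>x. 1))"
    have d: "d > 0" "d * \<Lambda> (\<lambda>x. 1) \<le> e"
      using e one_nonneg by (auto simp: d_def field_simps)
    have "\<exists>n. \<forall>x\<in>K. h n x < d"
    proof -
      have op: "open {x. h n x < d}" for n
      proof -
        obtain B where "bl B (h n)" using h_bl by blast
        then show ?thesis
          by (intro open_Collect_less bl_continuous_on[of B] continuous_on_const)
      qed
      have cov: "K \<subseteq> (\<Union>n\<in>UNIV. {x. h n x < d})"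
      proof
        fix x
        obtain n where "h n x \<le> 0" using h_lim by blast
        then have "h n x < d" using d(1) by linarith
        then show "x \<in> (\<Union>n\<in>UNIV. {x. h n x < d})" by blast
      qed
      obtain C where C: "finite C" "K \<subseteq> (\<Union>n\<in>C. {x. h n x < d})"
        by (rule compactE_image[OF K, of UNIV "\<lambda>n. {x. h n x < d}"]) (use op cov in auto)
      define n where "n = Max (insert 0 C)"
      have "h n x < d" if xK: "x \<in> K" for x
      proof -
        obtain m where m: "m \<in> C" "h m x < d" using C xK by auto
        then have "m \<le> n" using C(1) by (simp add: n_def)
        then show ?thesis using h_anti[of m n x] m by linarith
      qed
      then show ?thesis by blast
    qed
    then obtain n where n: "\<And>x. x \<in> K \<Longrightarrow> h n x < d" by blast
    obtain B where B: "bl B (\<lambda>x. \<Sum>i<n. g i n x)"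
      using bl_sum[of "{..<n}" "\<lambda>i. g i n"] g_bl by blast
    have gpos: "0 \<le> \<Lambda> (g i n)" for i using g_bl[of i n] nonneg g0 by blast
    have "\<Lambda> f \<le> \<Lambda> (\<lambda>x. (\<Sum>i<n. g i n x) + d)"
      by (rule mono[OF A bl_add[OF B bl_const]]) (use n in \<open>force simp: h_def\<close>)
    also have "\<dots> = (\<Sum>i<n. \<Lambda> (g i n)) + d * \<Lambda> (\<lambda>x. 1)"
      using add[OF B bl_const[of d]] sum[of "{..<n}" "\<lambda>i. g i n"] g_bl const[of d] by simp
    also have "\<dots> \<le> (\<Sum>i<n. \<Lambda> (g i n)) + e" using d by simp
    finally have "ennreal (\<Lambda> f) \<le> ennreal ((\<Sum>i<n. \<Lambda> (g i n)) + e)" by (rule ennreal_leI)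
    also have "\<dots> = (\<Sum>i<n. ennreal (\<Lambda> (g i n))) + ennreal e"
      using e gpos by (simp add: sum_nonneg sum_ennreal)
    also have "\<dots> \<le> (\<Sum>i<n. content (U i)) + ennreal e"
      by (intro add_right_mono sum_mono content_ge g)
    also have "\<dots> \<le> (\<Sum>i. content (U i)) + ennreal e"
      by (intro add_right_mono sum_le_suminf) auto
    finally show "ennreal (\<Lambda> f) \<le> (\<Sum>i. content (U i)) + ennreal e" .
  qed
qed

lemma outer_UN_le: "outer (\<Union>i::nat. X i) \<le> (\<Sum>i. outer (X i))"
proof (rule ennreal_le_epsilon)
  fix e :: real assume e: "0 < e"
  have "\<exists>U. open U \<and> X i \<subseteq> U \<and> content U \<le> outer (X i) + ennreal (e * (1/2) ^ Suc i)" for i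
  proof -
    \<comment> \<open>Finiteness is what makes adding a positive amount a strict increase in
      \<open>ennreal\<close>.\<close>
    have fin: "outer (X i) < \<infinity>"
      using outer_le[of "X i"] by (simp add: ennreal_less_top le_less_trans)
    have "outer (X i) < outer (X i) + ennreal (e * (1/2) ^ Suc i)"
      using fin e by (cases "outer (X i)") (auto simp: ennreal_plus[symmetric] ennreal_less_iff simp del: ennreal_plus)
    then show ?thesis
      unfolding outer_def[of "X i"] by (subst (asm) INF_less_iff) (auto intro: less_imp_le simp: outer_def)
  qed
  then obtain U where U: "\<And>i. open (U i)" "\<And>i. X i \<subseteq> U i"
      "\<And>i. content (U i) \<le> outer (X i) + ennreal (e * (1/2) ^ Suc i)"
    by metis
  have "outer (\<Union>i. X i) \<le> outer (\<Union>i. U i)" using U(2) by (intro outer_mono) blast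
  also have "\<dots> = content (\<Union>i. U i)" using U(1) by (intro outer_open) auto
  also have "\<dots> \<le> (\<Sum>i. content (U i))" by (intro content_UN_le U)
  also have "\<dots> \<le> (\<Sum>i. outer (X i) + ennreal (e * (1/2) ^ Suc i))"
    by (intro suminf_le U) auto
  also have "\<dots> = (\<Sum>i. outer (X i)) + (\<Sum>i. ennreal (e * (1/2) ^ Suc i))"
    by (simp add: suminf_add)
  also have "(\<Sum>i. ennreal (e * (1/2) ^ Suc i)) = ennreal e"
    using sums_mult[OF power_half_series, of e] e
    by (intro suminf_ennreal_eq) auto
  finally show "outer (\<Union>i. X i) \<le> (\<Sum>i. outer (X i)) + ennreal e" .
qed

lemma outer_measure_space_outer: "outer_measure_space (Pow UNIV) outer"
  unfolding outer_measure_space_def positive_def increasing_def countably_subadditive_def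
  using outer_open[of "{}"] content_empty outer_UN_le by (auto intro: outer_mono)

lemma outer_Un_le: "outer (X \<union> Y) \<le> outer X + outer Y"
proof -
  have "outer (\<Union>i::nat. if i = 0 then X else if i = 1 then Y else {})
      \<le> (\<Sum>i::nat. outer (if i = 0 then X else if i = 1 then Y else {}))"
    by (rule outer_UN_le)
  also have "\<dots> = (\<Sum>i\<in>{0,1::nat}. outer (if i = 0 then X else if i = 1 then Y else {}))"
    using outer_open[of "{}"] content_empty by (intro suminf_finite) auto
  also have "\<dots> = outer X + outer Y" by simp
  also have "(\<Union>i::nat. if i = 0 then X else if i = 1 then Y else {}) = X \<union> Y"
    by (auto split: if_splits)
  finally show ?thesis .
qed

text \<open>Given a minorant \<open>f\<close> of \<open>U \<inter> W\<close>, lower it to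
  \<open>fd\<close>, the positive part of \<open>f - d\<close>. The open set \<open>Q\<close> of
  points of \<open>W\<close> with \<open>f < d\<close> contains \<open>W - U\<close>, and
  \<open>fd\<close> vanishes on it. Hence \<open>fd + g\<close> is a minorant of \<open>W\<close>
  for every minorant \<open>g\<close> of \<open>Q\<close>, and the loss is at most
  \<open>e\<close>.\<close>

lemma content_split:
  assumes "open U" "open W"
  shows "content (U \<inter> W) + outer (W - U) \<le> content W"
proof -
  have "ennreal (\<Lambda> f) + outer (W - U) \<le> content W" if f: "f \<in> bl_below (U \<inter> W)" for f
  proof (rule ennreal_le_epsilon)
    fix e :: real assume e: "0 < e"
    define d where "d = e / (1 + \<Lambda> (\<lambda>x. 1))"
    have d: "d > 0" "d * \<Lambda> (\<lambda>x. 1) \<le> e"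
      using e one_nonneg by (auto simp: d_def field_simps)
    obtain A where A: "bl A f" using f by (auto simp: bl_below_def)
    define fd where "fd x = max 0 (f x + - d)" for x
    have fd: "bl (\<bar>0\<bar> + (A + \<bar>- d\<bar>)) fd"
      unfolding fd_def by (intro bl_max bl_add bl_const A)
    have fd0: "0 \<le> \<Lambda> fd" by (rule nonneg[OF fd]) (simp add: fd_def)
    define Q where "Q = W \<inter> {x. f x < d}"
    have Q: "open Q"
      unfolding Q_def using A assms
      by (intro open_Int open_Collect_less bl_continuous_on[of A] continuous_on_const)
    have sub: "W - U \<subseteq> Q" using f d(1) by (auto simp: bl_below_def Q_def)
    have "\<Lambda> f \<le> \<Lambda> (\<lambda>x. fd x + d)"
      by (rule mono[OF A bl_add[OF fd bl_const]]) (simp add: fd_def)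
    also have "\<dots> \<le> \<Lambda> fd + e"
      using add[OF fd bl_const[of d]] const[of d] d by simp
    finally have 1: "ennreal (\<Lambda> f) \<le> ennreal (\<Lambda> fd) + ennreal e"
      using fd0 e by (metis ennreal_leI ennreal_plus less_imp_le)
    have "ennreal (\<Lambda> fd) + ennreal (\<Lambda> g) \<le> content W" if g: "g \<in> bl_below Q" for g
    proof -
      obtain B where B: "bl B g" using g by (auto simp: bl_below_def)
      have g0: "0 \<le> \<Lambda> g" by (rule nonneg[OF B]) (use g in \<open>auto simp: bl_below_def\<close>)
      have "fd x + g x \<le> 1 \<and> (x \<notin> W \<longrightarrow> fd x + g x = 0) \<and> 0 \<le> fd x + g x" for x
      proof -
        have "0 \<le> f x" "f x \<le> 1" "0 \<le> g x" "g x \<le> 1" "x \<notin> U \<inter> W \<longrightarrow> f x = 0" "x \<notin> Q \<longrightarrow> g x = 0"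
          using f g by (auto simp: bl_below_def)
        then show ?thesis using d(1) by (cases "x \<in> Q") (auto simp: fd_def Q_def)
      qed
      then have "(\<lambda>x. fd x + g x) \<in> bl_below W"
        unfolding bl_below_def using bl_add[OF fd B] by auto
      from content_ge[OF this] show ?thesis
        using add[OF fd B] fd0 g0 by simp
    qed
    then have "(SUP g\<in>bl_below Q. ennreal (\<Lambda> fd) + ennreal (\<Lambda> g)) \<le> content W"
      by (rule SUP_least)
    moreover have "bl_below Q \<noteq> {}" using bl_const[of 0] by (force simp: bl_below_def)
    ultimately have 2: "ennreal (\<Lambda> fd) + content Q \<le> content W"
      unfolding content_def[of Q] by (simp add: ennreal_SUP_add_right)
    have "ennreal (\<Lambda> f) + outer (W - U) \<le> (ennreal (\<Lambda> fd) + ennreal e) + content Q"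
      using outer_mono[OF sub] outer_open[OF Q] by (intro add_mono 1) simp
    also have "\<dots> = (ennreal (\<Lambda> fd) + content Q) + ennreal e" by (simp add: ac_simps)
    also have "\<dots> \<le> content W + ennreal e" by (intro add_right_mono 2)
    finally show "ennreal (\<Lambda> f) + outer (W - U) \<le> content W + ennreal e" .
  qed
  then have "(SUP f\<in>bl_below (U \<inter> W). ennreal (\<Lambda> f) + outer (W - U)) \<le> content W"
    by (rule SUP_least)
  moreover have "bl_below (U \<inter> W) \<noteq> {}" using bl_const[of 0] by (force simp: bl_below_def)
  ultimately show ?thesis
    unfolding content_def[of "U \<inter> W"] by (simp add: ennreal_SUP_add_left)
qed

text \<open>Caratheodory's condition for an arbitrary \<open>X\<close> reduces to the open sets
  containing \<open>X\<close>, where \<open>content_split\<close> applies.\<close>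

lemma open_in_lambda_system:
  assumes U: "open U" shows "U \<in> lambda_system UNIV (Pow UNIV) outer"
proof -
  have "outer (U \<inter> X) + outer (- U \<inter> X) = outer X" for X
  proof (rule antisym)
    have "(U \<inter> X) \<union> (- U \<inter> X) = X" by auto
    then show "outer X \<le> outer (U \<inter> X) + outer (- U \<inter> X)"
      using outer_Un_le[of "U \<inter> X" "- U \<inter> X"] by simp
    show "outer (U \<inter> X) + outer (- U \<inter> X) \<le> outer X"
      unfolding outer_def[of X]
    proof (rule INF_greatest)
      fix W assume W: "W \<in> {W. open W \<and> X \<subseteq> W}"
      have "outer (U \<inter> X) + outer (- U \<inter> X) \<le> outer (U \<inter> W) + outer (W - U)"
        using W by (intro add_mono outer_mono) auto
      also have "outer (U \<inter> W) = content (U \<inter> W)" using W U by (intro outer_open) auto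
      also have "content (U \<inter> W) + outer (W - U) \<le> content W"
        using W U by (intro content_split) auto
      finally show "outer (U \<inter> X) + outer (- U \<inter> X) \<le> content W" .
    qed
  qed
  then show ?thesis by (simp add: lambda_system_def Compl_eq_Diff_UNIV)
qed

definition riesz_measure :: "'b measure" where
  "riesz_measure = measure_of UNIV (sets borel) outer"

lemma emeasure_riesz: "X \<in> sets borel \<Longrightarrow> emeasure riesz_measure X = outer X"
  and sets_riesz: "sets riesz_measure = sets borel"
proof -
  interpret Pow: sigma_algebra UNIV "Pow UNIV :: 'b set set" by (rule sigma_algebra_Pow)
  let ?L = "lambda_system UNIV (Pow UNIV) outer"
  have L: "measure_space UNIV ?L outer"
    using Pow.caratheodory_lemma[OF outer_measure_space_outer] .
  have "sigma_sets UNIV {U. open U} \<subseteq> ?L"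
    using L open_in_lambda_system
    by (intro sigma_algebra.sigma_sets_subset) (auto simp: measure_space_def)
  then have sub: "sets borel \<subseteq> ?L" by (simp add: borel_def)
  have ca: "countably_additive (sets borel) outer" "positive (sets borel) outer"
    using L sub unfolding measure_space_def countably_additive_def positive_def
    by (auto dest: subsetD)
  have sa: "sigma_algebra UNIV (sets (borel :: 'b measure))"
    using sets.sigma_algebra_axioms[of "borel :: 'b measure"] by simp
  show "sets riesz_measure = sets borel"
    unfolding riesz_measure_def using sigma_algebra.sets_measure_of_eq[OF sa] by simp
  show "emeasure riesz_measure X = outer X" if "X \<in> sets borel"
    unfolding riesz_measure_def
    by (rule emeasure_measure_of_sigma[OF sa ca(2,1) that])
qed

lemma fin_meas_riesz: "fin_meas riesz_measure"
  unfolding fin_meas_def using emeasure_riesz[of UNIV] sets_riesz outer_le[of UNIV]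
  by (auto simp: ennreal_less_top le_less_trans)

lemma mass_riesz: "measure riesz_measure UNIV = \<Lambda> (\<lambda>x. 1)"
  using emeasure_riesz[of UNIV] outer_open[of UNIV] content_UNIV one_nonneg
  by (simp add: measure_def)

lemma AE_riesz: "AE x in riesz_measure. x \<in> K"
proof (rule AE_I[where N = "- K"])
  have "open (- K)" using K compact_imp_closed by (auto simp: closed_def)
  then show "emeasure riesz_measure (- K) = 0" "- K \<in> sets riesz_measure"
    using emeasure_riesz[of "- K"] outer_open[of "- K"] content_Compl_K sets_riesz by auto
qed (use fin_measD(2)[OF fin_meas_riesz] in auto)

text \<open>The layer-cake sum: \<open>n f\<close> is the sum of the truncations \<open>min 1 (max 0 (n f - k))\<close>, each
  dominated by the indicator of the open set on which \<open>f\<close> exceeds \<open>k / n\<close>.\<close>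

lemma le_integral_riesz:
  assumes A: "bl A f" and f: "\<And>x. 0 \<le> f x" "\<And>x. f x \<le> 1"
  shows "\<Lambda> f \<le> (\<integral>x. f x \<partial>riesz_measure)"
proof -
  let ?M = riesz_measure
  interpret finite_measure ?M by (rule fin_measD(1)[OF fin_meas_riesz])
  have int: "integrable ?M f" using bl_integrable[OF fin_meas_riesz A] .
  \<comment> \<open>Dividing by \<open>n\<close> and letting \<open>n\<close> grow removes the mass
    term.\<close>
  have step: "real n * \<Lambda> f \<le> real n * (\<integral>x. f x \<partial>?M) + measure ?M UNIV" for n
  proof -
    define g where "g k x = min 1 (max 0 (real n * f x + - real k))" for k :: nat and x
    define U where "U k = {x. real k < real n * f x}" for k :: nat
    have g_bl: "bl (\<bar>1\<bar> + (\<bar>0\<bar> + (\<bar>real n\<bar> * A + \<bar>- real k\<bar>))) (g k)" for k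
      unfolding g_def by (intro bl_min bl_max bl_add bl_cmult bl_const A)
    have U: "open (U k)" for k
      unfolding U_def using bl_continuous_on[OF bl_cmult[OF A, of "real n"]]
      by (intro open_Collect_less continuous_on_const) auto
    have gU: "g k \<in> bl_below (U k)" for k
      unfolding bl_below_def using g_bl[of k] by (auto simp: g_def U_def)
    have le: "\<Lambda> (g k) \<le> measure ?M (U k)" for k
    proof -
      have "ennreal (\<Lambda> (g k)) \<le> emeasure ?M (U k)"
        using content_ge[OF gU[of k]] emeasure_riesz[of "U k"] outer_open[OF U[of k]] U[of k] by simp
      then show ?thesis
        by (metis emeasure_eq_measure ennreal_le_iff measure_nonneg)
    qed
    have trunc: "(\<Sum>k<m. min 1 (max 0 (y + - real k))) = min (real m) y" if "0 \<le> y" for y m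
    proof (induction m)
      case 0 then show ?case using that by simp
    next
      case (Suc m) then show ?case by (auto simp: min_def max_def)
    qed
    have gsum: "(\<Sum>k<n. g k x) = real n * f x" for x
    proof -
      have "real n * f x \<le> real n" using f[of x] by (simp add: mult_left_le)
      then show ?thesis unfolding g_def using trunc[of "real n * f x" n] f[of x] by simp
    qed
    have "real n * \<Lambda> f = \<Lambda> (\<lambda>x. \<Sum>k<n. g k x)"
      unfolding gsum using cmult[OF A] by simp
    also have "\<dots> = (\<Sum>k<n. \<Lambda> (g k))" using g_bl by (intro sum) auto
    also have "\<dots> \<le> (\<Sum>k<n. measure ?M (U k))" by (intro sum_mono le)
    also have "\<dots> = (\<integral>x. (\<Sum>k<n. indicator (U k) x) \<partial>?M)"
      using U by (subst Bochner_Integration.integral_sum) (auto simp: sets_riesz fin_measD[OF fin_meas_riesz] emeasure_eq_measure)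
    also have "\<dots> \<le> (\<integral>x. real n * f x + 1 \<partial>?M)"
    proof (rule integral_mono)
      show "integrable ?M (\<lambda>x. \<Sum>k<n. indicator (U k) x :: real)"
        using U by (intro Bochner_Integration.integrable_sum) (auto simp: sets_riesz emeasure_eq_measure)
      show "integrable ?M (\<lambda>x. real n * f x + 1)" using int by auto
      fix x
      \<comment> \<open>For \<open>y \<ge> 0\<close>, at most \<open>y + 1\<close> natural numbers
        lie below \<open>y\<close>; integrating the surplus 1 gives the mass term in
        \<open>step\<close>.\<close>
      have ind: "(\<Sum>k<m. if real k < y then 1 else 0 :: real) \<le> y + 1" if "0 \<le> y" for y m
      proof -
        have "(\<Sum>k<m. if real k < y then 1 else 0 :: real) = (\<Sum>k\<in>{k\<in>{..<m}. real k < y}. 1)"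
          by (rule sum.inter_filter[symmetric]) simp
        also have "\<dots> = real (card {k\<in>{..<m}. real k < y})" by simp
        also have "card {k\<in>{..<m}. real k < y} \<le> card {..nat \<lfloor>y\<rfloor>}"
        proof (rule card_mono)
          have "k \<le> nat \<lfloor>y\<rfloor>" if "real k < y" for k using that by linarith
          then show "{k\<in>{..<m}. real k < y} \<subseteq> {..nat \<lfloor>y\<rfloor>}" by auto
        qed simp
        also have "real (card {..nat \<lfloor>y\<rfloor>}) \<le> y + 1" using \<open>0 \<le> y\<close> by simp
        finally show ?thesis by simp
      qed
      show "(\<Sum>k<n. indicator (U k) x) \<le> real n * f x + 1"
        using ind[of "real n * f x" n] f[of x] by (simp add: U_def indicator_def of_bool_def)
    qed
    also have "\<dots> = real n * (\<integral>x. f x \<partial>?M) + measure ?M UNIV"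
      using int fin_measD(2)[OF fin_meas_riesz] by simp
    finally show ?thesis .
  qed
  show ?thesis
  proof (rule ccontr)
    assume "\<not> ?thesis"
    then obtain n where "measure ?M UNIV < real n * (\<Lambda> f - (\<integral>x. f x \<partial>?M))"
      using reals_Archimedean3[of "\<Lambda> f - (\<integral>x. f x \<partial>?M)"] by auto
    then show False using step[of n] by (simp add: algebra_simps)
  qed
qed

text \<open>An affine change moves \<open>f\<close> into the unit interval. The one-sided inequality
  for both \<open>g\<close> and \<open>1 - g\<close> forces equality, because the total mass is
  exactly \<open>\<Lambda> (\<lambda>x. 1)\<close>.\<close>

lemma integral_riesz:
  assumes A: "bl A f" shows "(\<integral>x. f x \<partial>riesz_measure) = \<Lambda> f"
proof -
  let ?M = riesz_measure
  interpret finite_measure ?M by (rule fin_measD(1)[OF fin_meas_riesz])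
  \<comment> \<open>Chosen so that \<open>b * f\<close> has absolute value at most 1/2; the added 1
    covers \<open>A = 0\<close>.\<close>
  define b where "b = 1 / (2 * A + 1)"
  have b: "b > 0" "b * A \<le> 1/2"
    using bl_nonneg[OF A] by (auto simp: b_def field_simps)
  define g where "g x = b * f x + 1/2" for x
  have g_bl: "bl (\<bar>b\<bar> * A + \<bar>1/2\<bar>) g" unfolding g_def by (intro bl_add bl_cmult A bl_const)
  have g: "0 \<le> g x" "g x \<le> 1" for x
  proof -
    have "\<bar>b * f x\<bar> \<le> b * A" unfolding abs_mult using b bl_bound[OF A, of x] by (simp add: mult_left_mono)
    then show "0 \<le> g x" "g x \<le> 1" using b unfolding g_def by linarith+
  qed
  have int: "integrable ?M g" "integrable ?M f"
    using bl_integrable[OF fin_meas_riesz] A g_bl by blast+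
  have "\<Lambda> (\<lambda>x. 1 - g x) \<le> (\<integral>x. 1 - g x \<partial>?M)"
    by (rule le_integral_riesz[OF bl_diff[OF bl_const g_bl]]) (use g in auto)
  also have "\<dots> = \<Lambda> (\<lambda>x. 1) - (\<integral>x. g x \<partial>?M)"
    using int fin_measD(2)[OF fin_meas_riesz] mass_riesz by simp
  finally have "(\<integral>x. g x \<partial>?M) \<le> \<Lambda> g"
    using add[OF bl_const[of 1] bl_uminus[OF g_bl]] cmult[OF g_bl, of "-1"] by simp
  then have "(\<integral>x. g x \<partial>?M) = \<Lambda> g"
    using le_integral_riesz[OF g_bl g] by simp
  moreover have "(\<integral>x. g x \<partial>?M) = b * (\<integral>x. f x \<partial>?M) + 1/2 * \<Lambda> (\<lambda>x. 1)"
    unfolding g_def using int(2) fin_measD(2)[OF fin_meas_riesz] mass_riesz by simp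
  moreover have "\<Lambda> g = b * \<Lambda> f + 1/2 * \<Lambda> (\<lambda>x. 1)"
    unfolding g_def using add[OF bl_cmult[OF A, of b] bl_const[of "1/2"]] cmult[OF A, of b] const[of "1/2"]
    by simp
  ultimately show ?thesis using b by simp
qed

end

subsection \<open>Compactness\<close>

text \<open>Round the values of \<open>f\<close> at a finite \<open>d\<close>-net of
  \<open>K\<close> down to multiples of \<open>d\<close>. Only finitely many patterns occur, and two
  functions with the same pattern differ by less than \<open>d\<close> on the net, hence by less
  than \<open>3 * d = e\<close> on \<open>K\<close>.\<close>

lemma bl_finite_net:
  fixes K :: "'b::metric_space set"
  assumes K: "compact K" and e: "0 < e"
  obtains F :: "('b \<Rightarrow> real) set" where "finite F" "\<And>g. g \<in> F \<Longrightarrow> bl 1 g"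
    "\<And>f. bl 1 f \<Longrightarrow> \<exists>g\<in>F. \<forall>x\<in>K. \<bar>f x - g x\<bar> \<le> e"
proof -
  define d where "d = e / 3"
  have d: "d > 0" using e by (simp add: d_def)
  obtain X where X: "finite X" "X \<subseteq> K" "K \<subseteq> (\<Union>x\<in>X. ball x d)"
    using compactE_image[OF K, of K "\<lambda>x. ball x d"] d by (metis UN_I centre_in_ball open_ball subsetI)
  define q where "q f = (\<lambda>x\<in>X. \<lfloor>f x / d\<rfloor>)" for f :: "'b \<Rightarrow> real"
  let ?S = "{f :: 'b \<Rightarrow> real. bl 1 f}"
  have "q ` ?S \<subseteq> (\<Pi>\<^sub>E x\<in>X. {\<lfloor>- 1 / d\<rfloor>..\<lfloor>1 / d\<rfloor>})"
  proof (intro image_subsetI PiE_I)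
    fix f :: "'b \<Rightarrow> real" and x assume "f \<in> ?S" "x \<in> X"
    then have "- 1 \<le> f x" "f x \<le> 1" using bl_bound[of 1 f x] by auto
    then have "- 1 / d \<le> f x / d" "f x / d \<le> 1 / d" using d by (intro divide_right_mono; simp)+
    then show "q f x \<in> {\<lfloor>- 1 / d\<rfloor>..\<lfloor>1 / d\<rfloor>}"
      using \<open>x \<in> X\<close> by (simp add: q_def floor_mono)
  qed (simp add: q_def)
  moreover have "finite (\<Pi>\<^sub>E x\<in>X. {\<lfloor>- 1 / d\<rfloor>..\<lfloor>1 / d\<rfloor>})"
    using X(1) by (intro finite_PiE) auto
  ultimately have fin: "finite (q ` ?S)" by (rule finite_subset)
  \<comment> \<open>One representative for each rounding pattern, chosen among the functions
    themselves so that it is again in the unit ball.\<close>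
  show ?thesis
  proof (rule that[of "inv_into ?S q ` q ` ?S"])
    show "finite (inv_into ?S q ` q ` ?S)" using fin by simp
    show "bl 1 g" if "g \<in> inv_into ?S q ` q ` ?S" for g
      using that inv_into_into[of _ q ?S] by blast
    fix f :: "'b \<Rightarrow> real" assume f: "bl 1 f"
    define g where "g = inv_into ?S q (q f)"
    have g: "bl 1 g" "q g = q f"
      using inv_into_into[of "q f" q ?S] f_inv_into_f[of "q f" q ?S] f by (auto simp: g_def)
    have "\<bar>f x - g x\<bar> \<le> e" if xK: "x \<in> K" for x
    proof -
      obtain y where y: "y \<in> X" "dist y x < d" using X(3) xK by auto
      have fl: "\<lfloor>f y / d\<rfloor> = \<lfloor>g y / d\<rfloor>" using fun_cong[OF g(2), of y] y(1) by (simp add: q_def)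
      have "\<bar>f y / d - g y / d\<bar> < 1" using fl by linarith
      then have "\<bar>f y - g y\<bar> < d"
        using d by (simp add: diff_divide_distrib[symmetric] divide_less_eq)
      moreover have "\<bar>f x - f y\<bar> \<le> dist y x" "\<bar>g x - g y\<bar> \<le> dist y x"
        using bl_lip[OF f, of x y] bl_lip[OF g(1), of x y] by (simp_all add: dist_commute)
      ultimately show ?thesis using y(2) unfolding d_def by linarith
    qed
    moreover have "g \<in> inv_into ?S q ` q ` ?S" using f by (simp add: g_def)
    ultimately show "\<exists>g\<in>inv_into ?S q ` q ` ?S. \<forall>x\<in>K. \<bar>f x - g x\<bar> \<le> e" by blast
  qed
qed

lemma integral_diff_le_on:
  fixes f g :: "'b::metric_space \<Rightarrow> real"
  assumes M: "fin_meas M" "AE x in M. x \<in> K" and f: "bl A f" and g: "bl B g"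
    and e: "\<And>x. x \<in> K \<Longrightarrow> \<bar>f x - g x\<bar> \<le> e" "0 \<le> e"
  shows "\<bar>(\<integral>x. f x \<partial>M) - (\<integral>x. g x \<partial>M)\<bar> \<le> e * measure M UNIV"
proof -
  have "(\<integral>x. f x \<partial>M) - (\<integral>x. g x \<partial>M) = (\<integral>x. f x - g x \<partial>M)"
    using bl_integrable[OF M(1)] f g by simp
  moreover have "AE x in M. \<bar>f x - g x\<bar> \<le> e" using M(2) by (rule AE_mp) (use e in auto)
  ultimately show ?thesis using integral_abs_le_mass[OF M(1) _ e(2)] by simp
qed

text \<open>Convergence of each single integral becomes uniform over the unit ball, since a finite
  net replaces the ball. The common compact set and the common mass bound make the replacement error
  independent of \<open>n\<close>.\<close>

lemma flat_tendsto_0: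
  fixes M :: "'b::metric_space measure" and N :: "nat \<Rightarrow> 'b measure"
  assumes K: "compact K"
    and M: "fin_meas M" "AE x in M. x \<in> K" "measure M UNIV \<le> m"
    and N: "\<And>n. fin_meas (N n)" "\<And>n. AE x in N n. x \<in> K" "\<And>n. measure (N n) UNIV \<le> m"
    and lim: "\<And>f. bl 1 f \<Longrightarrow> (\<lambda>n. \<integral>x. f x \<partial>N n) \<longlonglongrightarrow> (\<integral>x. f x \<partial>M)"
  shows "(\<lambda>n. flat (N n) M) \<longlonglongrightarrow> 0"
proof (rule LIMSEQ_I)
  fix r :: real assume r: "0 < r"
  have m: "0 \<le> m" using M(3) measure_nonneg[of M UNIV] by linarith
  \<comment> \<open>Two replacement errors of at most \<open>r / 4\<close> and one convergence error
    below \<open>r / 4\<close>; \<open>m + 1\<close> admits \<open>m = 0\<close>.\<close>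
  define e where "e = r / (4 * (m + 1))"
  have e: "e > 0" "e * m \<le> r / 4" using r m by (auto simp: e_def field_simps)
  obtain F :: "('b \<Rightarrow> real) set" where F: "finite F" "\<And>g. g \<in> F \<Longrightarrow> bl 1 g"
    "\<And>f. bl 1 f \<Longrightarrow> \<exists>g\<in>F. \<forall>x\<in>K. \<bar>f x - g x\<bar> \<le> e"
    using bl_finite_net[OF K e(1)] by metis
  have "\<forall>\<^sub>F n in sequentially. \<forall>g\<in>F. dist (\<integral>x. g x \<partial>N n) (\<integral>x. g x \<partial>M) < r / 4"
  proof (rule eventually_ball_finite[OF F(1)], rule ballI)
    fix g assume "g \<in> F"
    then show "\<forall>\<^sub>F n in sequentially. dist (\<integral>x. g x \<partial>N n) (\<integral>x. g x \<partial>M) < r / 4"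
      using tendstoD[OF lim[OF F(2)], of g "r / 4"] r by simp
  qed
  then obtain n0 where n0: "\<And>n g. n \<ge> n0 \<Longrightarrow> g \<in> F \<Longrightarrow> \<bar>(\<integral>x. g x \<partial>N n) - (\<integral>x. g x \<partial>M)\<bar> < r / 4"
    unfolding eventually_sequentially dist_real_def by blast
  have "norm (flat (N n) M - 0) < r" if n: "n \<ge> n0" for n
  proof -
    have "flat (N n) M \<le> 3 * r / 4"
    proof (rule flat_le)
      fix f :: "'b \<Rightarrow> real" assume f: "bl 1 f"
      obtain g where g: "g \<in> F" "\<And>x. x \<in> K \<Longrightarrow> \<bar>f x - g x\<bar> \<le> e" using F(3)[OF f] by blast
      have "\<bar>(\<integral>x. f x \<partial>N n) - (\<integral>x. g x \<partial>N n)\<bar> \<le> e * m"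
        using integral_diff_le_on[OF N(1,2) f F(2)[OF g(1)] g(2), of n] e(1) N(3)[of n]
        by (meson less_imp_le mult_left_mono order_trans)
      moreover have "\<bar>(\<integral>x. f x \<partial>M) - (\<integral>x. g x \<partial>M)\<bar> \<le> e * m"
        using integral_diff_le_on[OF M(1,2) f F(2)[OF g(1)] g(2)] e(1) M(3)
        by (meson less_imp_le mult_left_mono order_trans)
      ultimately show "(\<integral>x. f x \<partial>N n) - (\<integral>x. f x \<partial>M) \<le> 3 * r / 4"
        using n0[OF n g(1)] e(2) by linarith
    qed
    then show ?thesis using flat_nonneg[OF N(1) M(1), of n] r by simp
  qed
  then show "\<exists>n0. \<forall>n\<ge>n0. norm (flat (N n) M - 0) < r" by blast
qed

text \<open>An Arzela--Ascoli theorem for measure-valued curves that are Lipschitz up to an error \<open>h n\<close>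
  tending to 0, so that curves which are piecewise constant in time are allowed.\<close>

lemma flat_curves_convergent_subsequence:
  fixes N :: "nat \<Rightarrow> real \<Rightarrow> 'b::metric_space measure"
  assumes K: "compact K" and T: "0 \<le> T"
    and N: "\<And>n t. t \<in> {0..T} \<Longrightarrow> fin_meas (N n t)"
      "\<And>n t. t \<in> {0..T} \<Longrightarrow> AE x in N n t. x \<in> K"
      "\<And>n t. t \<in> {0..T} \<Longrightarrow> measure (N n t) UNIV \<le> m"
    and lip: "\<And>n t r. t \<in> {0..T} \<Longrightarrow> r \<in> {0..T} \<Longrightarrow> flat (N n t) (N n r) \<le> C * (\<bar>t - r\<bar> + h n)"
    and h: "h \<longlonglongrightarrow> 0"
    and init: "\<And>n. N n 0 = \<mu>0"
  obtains k \<mu> where "strict_mono (k :: nat \<Rightarrow> nat)" "\<mu> 0 = \<mu>0"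
    "\<And>t. t \<in> {0..T} \<Longrightarrow> fin_meas (\<mu> t)" "\<And>t. t \<in> {0..T} \<Longrightarrow> AE x in \<mu> t. x \<in> K"
    "\<And>t. t \<in> {0..T} \<Longrightarrow> measure (\<mu> t) UNIV \<le> m"
    "\<And>t. t \<in> {0..T} \<Longrightarrow> (\<lambda>n. flat (N (k n) t) (\<mu> t)) \<longlonglongrightarrow> 0"
proof -
  have m: "0 \<le> m" using order_trans[OF measure_nonneg N(3)[of 0 0]] T by simp
  have "\<exists>F :: ('b \<Rightarrow> real) set. finite F \<and> (\<forall>g\<in>F. bl 1 g) \<and>
    (\<forall>f. bl 1 f \<longrightarrow> (\<exists>g\<in>F. \<forall>x\<in>K. \<bar>f x - g x\<bar> \<le> 1 / Suc j))" for j
    by (rule bl_finite_net[OF K, of "1 / Suc j"]) auto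
  then obtain F :: "nat \<Rightarrow> ('b \<Rightarrow> real) set" where F: "\<And>j. finite (F j)" "\<And>j g. g \<in> F j \<Longrightarrow> bl 1 g"
    "\<And>j f. bl 1 f \<Longrightarrow> \<exists>g\<in>F j. \<forall>x\<in>K. \<bar>f x - g x\<bar> \<le> 1 / Suc j" by metis
  \<comment> \<open>Pairs of a rational time and a net function: countable, so a diagonal
    subsequence exists, and dense enough for all times and all test functions.\<close>
  define D where "D = (\<rat> \<inter> {0..T}) \<times> (\<Union>j. F j)"
  have "countable D"
    unfolding D_def using F(1) by (intro countable_SIGMA countable_Int1 countable_rat countable_UN)
       (auto intro: countable_finite)
  moreover have "norm (\<integral>x. snd p x \<partial>N n (fst p)) \<le> m" if "p \<in> D" for n p
  proof -
    have "fst p \<in> {0..T}" "bl 1 (snd p)" using that F(2) by (auto simp: D_def)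
    then show ?thesis
      using bl_integral_abs_le[OF N(1), of "fst p" 1 "snd p" n] N(3)[of "fst p" n] by simp
  qed
  ultimately have "\<exists>k. strict_mono (k :: nat \<Rightarrow> nat) \<and>
    (\<forall>p\<in>D. \<exists>l. (\<lambda>n. \<integral>x. snd p x \<partial>N (k n) (fst p)) \<longlonglongrightarrow> l)"
    by (rule function_convergent_subsequence[of D "\<lambda>n p. \<integral>x. snd p x \<partial>N n (fst p)" m])
       (assumption, rule exI, rule conjI, assumption, blast)
  then obtain k where k: "strict_mono (k :: nat \<Rightarrow> nat)"
    "\<And>p. p \<in> D \<Longrightarrow> \<exists>l. (\<lambda>n. \<integral>x. snd p x \<partial>N (k n) (fst p)) \<longlonglongrightarrow> l"
    by blast
  have hk: "(\<lambda>n. h (k n)) \<longlonglongrightarrow> 0"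
    using LIMSEQ_subseq_LIMSEQ[OF h k(1)] by (simp add: o_def)
  have conv1: "convergent (\<lambda>n. \<integral>x. f x \<partial>N (k n) t)" if f: "bl 1 f" and t: "t \<in> {0..T}" for f t
    unfolding Cauchy_convergent_iff[symmetric]
  proof (rule metric_CauchyI)
    fix e :: real assume e: "0 < e"
    obtain j where j: "m / real (Suc j) < e / 6"
    proof -
      obtain j where "6 * m / e < real j" using reals_Archimedean2 by blast
      then have "6 * m / e < real (Suc j)" by simp
      then show ?thesis using e that[of j] by (simp add: field_simps)
    qed
    obtain g where g: "g \<in> F j" "\<And>x. x \<in> K \<Longrightarrow> \<bar>f x - g x\<bar> \<le> 1 / Suc j"
      using F(3)[OF f] by blast
    \<comment> \<open>\<open>C\<close> carries no sign assumption; \<open>C'\<close> is a positive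
      bound for its absolute value.\<close>
    define C' where "C' = \<bar>C\<bar> + 1"
    have C': "C' > 0" "C \<le> C'" by (auto simp: C'_def)
    \<comment> \<open>The rational time is sought to the left of \<open>t\<close> in order to stay
      in the interval; \<open>t = 0\<close> is rational itself.\<close>
    obtain q where q: "q \<in> \<rat> \<inter> {0..T}" "\<bar>t - q\<bar> < e / (12 * C')"
    proof (cases "t = 0")
      case True
      then show ?thesis using that[of 0] T e C' by simp
    next
      case False
      then have "max 0 (t - e / (12 * C')) < t" using t e C' by simp
      then obtain q where "q \<in> \<rat>" "max 0 (t - e / (12 * C')) < q" "q < t"
        using Rats_dense_in_real by blast
      then show ?thesis using that[of q] t by auto
    qed
    have "(q, g) \<in> D" using q g by (auto simp: D_def)
    then have cau: "Cauchy (\<lambda>n. \<integral>x. g x \<partial>N (k n) q)"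
      using k(2)[of "(q, g)"] by (auto simp: Cauchy_convergent_iff convergent_def)
    obtain n1 where n1: "\<And>a b. a \<ge> n1 \<Longrightarrow> b \<ge> n1 \<Longrightarrow>
        \<bar>(\<integral>x. g x \<partial>N (k a) q) - (\<integral>x. g x \<partial>N (k b) q)\<bar> < e / 6"
      using metric_CauchyD[OF cau, of "e / 6"] e unfolding dist_real_def by auto
    obtain n2 where n2: "\<And>n. n \<ge> n2 \<Longrightarrow> \<bar>h (k n)\<bar> < e / (12 * C')"
      using LIMSEQ_D[OF hk, of "e / (12 * C')"] e C' by auto
    \<comment> \<open>A net error and a time shift of \<open>e / 6\<close> each. Two such
      differences and the Cauchy error \<open>e / 6\<close> remain below \<open>e\<close>.\<close>
    have key: "\<bar>(\<integral>x. f x \<partial>N (k n) t) - (\<integral>x. g x \<partial>N (k n) q)\<bar> \<le> e / 3" if n: "n \<ge> n2" for n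
    proof -
      have qT: "q \<in> {0..T}" using q by simp
      have "\<bar>(\<integral>x. f x \<partial>N (k n) t) - (\<integral>x. g x \<partial>N (k n) t)\<bar> \<le> 1 / Suc j * measure (N (k n) t) UNIV"
        using t g by (intro integral_diff_le_on[OF N(1,2) f F(2)[OF g(1)]]) auto
      also have "\<dots> \<le> 1 / Suc j * m" using N(3)[OF t] by (intro mult_left_mono) auto
      also have "\<dots> = m / real (Suc j)" by simp
      also have "\<dots> \<le> e / 6" using j by (rule less_imp_le)
      finally have 1: "\<bar>(\<integral>x. f x \<partial>N (k n) t) - (\<integral>x. g x \<partial>N (k n) t)\<bar> \<le> e / 6" .
      have "\<bar>(\<integral>x. g x \<partial>N (k n) t) - (\<integral>x. g x \<partial>N (k n) q)\<bar> \<le> 1 * flat (N (k n) t) (N (k n) q)"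
        by (rule bl_integral_diff_le[OF N(1)[OF t] N(1)[OF qT] F(2)[OF g(1)]])
      also have "\<dots> \<le> C * (\<bar>t - q\<bar> + h (k n))" using lip[OF t qT] by simp
      also have "\<dots> \<le> \<bar>C * (\<bar>t - q\<bar> + h (k n))\<bar>" by simp
      also have "\<dots> \<le> C' * (\<bar>t - q\<bar> + \<bar>h (k n)\<bar>)"
        unfolding abs_mult by (intro mult_mono) (auto simp: C'_def)
      also have "\<dots> \<le> C' * (e / (12 * C') + e / (12 * C'))"
        using q(2) n2[OF n] C' by (intro mult_left_mono add_mono) auto
      also have "\<dots> = e / 6" using C' by (simp add: field_simps)
      finally show ?thesis using 1 by linarith
    qed
    show "\<exists>M. \<forall>a\<ge>M. \<forall>b\<ge>M. dist (\<integral>x. f x \<partial>N (k a) t) (\<integral>x. f x \<partial>N (k b) t) < e"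
    proof (intro exI allI impI)
      fix a b assume "max n1 n2 \<le> a" "max n1 n2 \<le> b"
      then have "n1 \<le> a" "n2 \<le> a" "n1 \<le> b" "n2 \<le> b" by auto
      from key[OF this(2)] key[OF this(4)] n1[OF this(1,3)]
      show "dist (\<integral>x. f x \<partial>N (k a) t) (\<integral>x. f x \<partial>N (k b) t) < e"
        using e unfolding dist_real_def by linarith
    qed
  qed
  have conv: "convergent (\<lambda>n. \<integral>x. f x \<partial>N (k n) t)" if f: "bl A f" and t: "t \<in> {0..T}" for A f t
  proof -
    define B where "B = A + 1"
    have B: "B > 0" "bl B f" using bl_nonneg[OF f] bl_mono[OF f] by (auto simp: B_def)
    have "bl 1 (\<lambda>x. (1 / B) * f x)" using bl_cmult[OF B(2), of "1 / B"] B(1) by simp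
    from conv1[OF this t] have "convergent (\<lambda>n. B * (\<integral>x. (1 / B) * f x \<partial>N (k n) t))"
      by (rule convergent_mult[OF convergent_const])
    then show ?thesis using B(1) by simp
  qed
  define P where "P t M \<longleftrightarrow> fin_meas M \<and> (AE x in M. x \<in> K) \<and>
    (\<forall>A f. bl A f \<longrightarrow> (\<lambda>n. \<integral>x. f x \<partial>N (k n) t) \<longlonglongrightarrow> (\<integral>x. f x \<partial>M))" for t and M :: "'b measure"
  have ex: "\<exists>M. P t M" if t: "t \<in> {0..T}" for t
  proof -
    define \<Lambda> where "\<Lambda> f = lim (\<lambda>n. \<integral>x. f x \<partial>N (k n) t)" for f :: "'b \<Rightarrow> real"
    have lim: "(\<lambda>n. \<integral>x. f x \<partial>N (k n) t) \<longlonglongrightarrow> \<Lambda> f" if "bl A f" for A f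
      using conv[OF that t] by (simp add: \<Lambda>_def convergent_LIMSEQ_iff)
    interpret bl_functional \<Lambda> K
    proof
      fix A B f g assume f: "bl A (f :: 'b \<Rightarrow> real)" and g: "bl B (g :: 'b \<Rightarrow> real)"
      have "(\<lambda>n. \<integral>x. f x + g x \<partial>N (k n) t) \<longlonglongrightarrow> \<Lambda> f + \<Lambda> g"
        using tendsto_add[OF lim[OF f] lim[OF g]] bl_integrable[OF N(1)[OF t] f] bl_integrable[OF N(1)[OF t] g]
        by simp
      then show "\<Lambda> (\<lambda>x. f x + g x) = \<Lambda> f + \<Lambda> g" by (simp add: \<Lambda>_def limI)
    next
      fix A a f assume f: "bl A (f :: 'b \<Rightarrow> real)"
      show "\<Lambda> (\<lambda>x. a * f x) = a * \<Lambda> f"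
        using limI[OF tendsto_mult_left[OF lim[OF f], of a]] by (simp add: \<Lambda>_def)
    next
      fix A f assume f: "bl A (f :: 'b \<Rightarrow> real)" "\<And>x. x \<in> K \<Longrightarrow> 0 \<le> f x"
      have "0 \<le> (\<integral>x. f x \<partial>N (k n) t)" for n
        by (rule integral_nonneg_AE, rule AE_mp[OF N(2)[OF t]]) (use f(2) in auto)
      then show "0 \<le> \<Lambda> f" by (intro LIMSEQ_le_const[OF lim[OF f(1)]]) auto
    qed (rule K)
    have "P t riesz_measure"
      unfolding P_def
    proof (intro conjI allI impI fin_meas_riesz AE_riesz)
      fix A f assume "bl A (f :: 'b \<Rightarrow> real)"
      then show "(\<lambda>n. \<integral>x. f x \<partial>N (k n) t) \<longlonglongrightarrow> (\<integral>x. f x \<partial>riesz_measure)"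
        using lim integral_riesz by metis
    qed
    then show ?thesis ..
  qed
  \<comment> \<open>The chosen limit is characterised only by its integrals. Taking
    \<open>\<mu>0\<close> itself at time 0 gives the initial condition as an equality of measures
    without a uniqueness argument.\<close>
  define \<mu> where "\<mu> t = (if t = 0 then \<mu>0 else SOME M. P t M)" for t
  have P0: "P 0 \<mu>0" using N(1)[of 0 0] N(2)[of 0 0] T unfolding P_def init by simp
  have P: "P t (\<mu> t)" if "t \<in> {0..T}" for t
    using P0 someI_ex[OF ex[OF that]] by (simp add: \<mu>_def)
  have mass: "measure (\<mu> t) UNIV \<le> m" if t: "t \<in> {0..T}" for t
  proof -
    have "(\<lambda>n. \<integral>x. 1 \<partial>N (k n) t) \<longlonglongrightarrow> (\<integral>x. (1::real) \<partial>\<mu> t)"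
      using P[OF t] bl_const[of 1] unfolding P_def by blast
    then have "(\<lambda>n. measure (N (k n) t) UNIV) \<longlonglongrightarrow> measure (\<mu> t) UNIV"
      using P[OF t] N(1)[OF t] by (simp add: P_def fin_measD(2))
    then show ?thesis using N(3)[OF t] by (meson LIMSEQ_le_const2)
  qed
  show ?thesis
  proof (rule that[of k \<mu>])
    show "\<mu> 0 = \<mu>0" by (simp add: \<mu>_def)
    fix t assume t: "t \<in> {0..T}"
    show "fin_meas (\<mu> t)" "AE x in \<mu> t. x \<in> K" using P[OF t] by (auto simp: P_def)
    show "(\<lambda>n. flat (N (k n) t) (\<mu> t)) \<longlonglongrightarrow> 0"
      by (rule flat_tendsto_0[OF K, where m = m])
         (use P[OF t] N[OF t] mass[OF t] in \<open>auto simp: P_def\<close>)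
  qed (use k mass in auto)
qed

subsection \<open>Test functions\<close>

lemma linear_eq_sum_Basis:
  fixes g :: "'a::euclidean_space \<Rightarrow> real"
  assumes "linear g" shows "g v = (\<Sum>i\<in>Basis. (v \<bullet> i) * g i)"
proof -
  have "g v = g (\<Sum>i\<in>Basis. (v \<bullet> i) *\<^sub>R i)" by (simp add: euclidean_representation)
  also have "\<dots> = (\<Sum>i\<in>Basis. (v \<bullet> i) * g i)"
    using assms by (simp add: linear_sum linear_scale)
  finally show ?thesis .
qed

lemma linear_abs_le_Basis:
  fixes g :: "'a::euclidean_space \<Rightarrow> real" and B :: real
  assumes "linear g" "\<And>i. i \<in> Basis \<Longrightarrow> \<bar>g i\<bar> \<le> B"
  shows "\<bar>g v\<bar> \<le> DIM('a) * B * norm v"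
proof -
  have "\<bar>g v\<bar> \<le> (\<Sum>i\<in>Basis. \<bar>(v \<bullet> i) * g i\<bar>)"
    unfolding linear_eq_sum_Basis[OF assms(1), of v] by (rule sum_abs)
  also have "\<dots> \<le> (\<Sum>i\<in>(Basis :: 'a set). norm v * B)"
    unfolding abs_mult using assms(2) by (intro sum_mono mult_mono) (auto simp: Basis_le_norm)
  finally show ?thesis by (simp add: mult_ac)
qed

lemma frechet_derivative_at_differentiable:
  assumes "f differentiable_on UNIV"
  shows "(f has_derivative frechet_derivative f (at x)) (at x)"
  using assms by (simp add: differentiable_on_def frechet_derivative_works)

lemma frechet_derivative_zero_outside:
  fixes f :: "'a::euclidean_space \<Rightarrow> real"
  assumes "x \<notin> closure {x. f x \<noteq> 0}"
  shows "frechet_derivative f (at x) = (\<lambda>v. 0)"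
proof -
  have "(f has_derivative (\<lambda>v. 0)) (at x)"
    by (rule has_derivative_transform_within_open[of "\<lambda>_. 0" _ _ _ "- closure {x. f x \<noteq> 0}"])
       (use assms closure_subset[of "{x. f x \<noteq> 0}"] in auto)
  then show ?thesis using frechet_derivative_at by metis
qed

lemma bounded_of_compact_support:
  fixes f :: "'a::metric_space \<Rightarrow> real"
  assumes "continuous_on UNIV f" "compact S" "\<And>x. x \<notin> S \<Longrightarrow> f x = 0"
  obtains B where "0 \<le> B" "\<And>x. \<bar>f x\<bar> \<le> B"
proof -
  have "bounded (f ` S)"
    using assms by (intro compact_imp_bounded compact_continuous_image) (auto intro: continuous_on_subset)
  then obtain B where B: "\<And>x. x \<in> S \<Longrightarrow> \<bar>f x\<bar> \<le> B"
    unfolding bounded_iff by auto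
  show ?thesis
  proof (rule that[of "\<bar>B\<bar>"])
    fix x show "\<bar>f x\<bar> \<le> \<bar>B\<bar>" using B[of x] assms(3)[of x] by (cases "x \<in> S") auto
  qed simp
qed

text \<open>The derivative is bounded by compactness, and the mean value inequality gives the
  Lipschitz constant. It is applied to a test function and again to each of its partial
  derivatives.\<close>

lemma bl_of_compact_support:
  fixes f :: "'a::euclidean_space \<Rightarrow> real"
  assumes f: "f differentiable_on UNIV"
    and cont: "\<And>i. i \<in> Basis \<Longrightarrow> continuous_on UNIV (\<lambda>x. frechet_derivative f (at x) i)"
    and S: "compact (closure {x. f x \<noteq> 0})"
  shows "\<exists>A. bl A f"
proof -
  let ?S = "closure {x. f x \<noteq> 0}"
  have fz: "f x = 0" if "x \<notin> ?S" for x using that closure_subset[of "{x. f x \<noteq> 0}"] by auto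
  obtain B where B: "0 \<le> B" "\<And>x. \<bar>f x\<bar> \<le> B"
    using bounded_of_compact_support[OF differentiable_imp_continuous_on[OF f] S fz] by metis
  have "\<exists>D. \<forall>x. \<bar>frechet_derivative f (at x) i\<bar> \<le> D" if "i \<in> Basis" for i
    using bounded_of_compact_support[OF cont[OF that] S] frechet_derivative_zero_outside[of _ f] by metis
  then obtain D where D: "\<And>i x. i \<in> Basis \<Longrightarrow> \<bar>frechet_derivative f (at x) i\<bar> \<le> D i" by metis
  define D' where "D' = (\<Sum>i\<in>Basis. \<bar>D i\<bar>)"
  have D': "\<bar>frechet_derivative f (at x) i\<bar> \<le> D'" if "i \<in> Basis" for i x
  proof -
    have "\<bar>D i\<bar> \<le> D'" unfolding D'_def by (rule member_le_sum) (use that in auto)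
    then show ?thesis using D[OF that, of x] by linarith
  qed
  have der: "(f has_derivative frechet_derivative f (at x)) (at x)" for x
    using frechet_derivative_at_differentiable[OF f] .
  have on: "onorm (frechet_derivative f (at x)) \<le> DIM('a) * D'" for x
  proof (rule onorm_bound)
    show "0 \<le> real DIM('a) * D'" by (simp add: D'_def sum_nonneg)
    fix v show "norm (frechet_derivative f (at x) v) \<le> DIM('a) * D' * norm v"
      using linear_abs_le_Basis[OF has_derivative_linear[OF der] D'] by simp
  qed
  have "\<bar>f x - f y\<bar> \<le> DIM('a) * D' * dist x y" for x y
    using differentiable_bound[OF convex_UNIV, of f "\<lambda>x. frechet_derivative f (at x)" "DIM('a) * D'" x y]
      der on by (simp add: dist_norm)
  moreover have "DIM('a) * D' * dist x y \<le> (B + DIM('a) * D') * dist x y" for x y :: 'a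
    using B by (simp add: distrib_right)
  moreover have "0 \<le> DIM('a) * D'" by (simp add: D'_def sum_nonneg)
  ultimately have "bl (B + DIM('a) * D') f"
    unfolding bl_def using B by (meson add_increasing2 order_trans)
  then show ?thesis ..
qed

text \<open>Second derivatives enter here: they make the gradient Lipschitz, as the flat estimate
  for \<open>drift\<close> and the quadratic Taylor remainder require. One constant serves for
  \<open>f\<close> and all partial derivatives.\<close>

lemma Cc_inf_bl:
  fixes f :: "'a::euclidean_space \<Rightarrow> real"
  assumes f: "Cc_inf f"
  obtains A where "bl A f" "\<And>i. i \<in> Basis \<Longrightarrow> bl A (\<lambda>x. frechet_derivative f (at x) i)"
proof -
  have Ck2: "Ck (Suc (Suc 0)) f" and S: "compact (closure {x. f x \<noteq> 0})"
    using f unfolding Cc_inf_def by blast+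
  have "\<exists>A. bl A f" using Ck2 S by (intro bl_of_compact_support) auto
  then obtain A0 where A0: "bl A0 f" ..
  have "\<exists>A. bl A (\<lambda>x. frechet_derivative f (at x) i)" if i: "i \<in> Basis" for i
  proof (rule bl_of_compact_support)
    let ?S = "closure {x. f x \<noteq> 0}"
    have "closure {x. frechet_derivative f (at x) i \<noteq> 0} \<subseteq> ?S"
      using frechet_derivative_zero_outside[of _ f] by (intro closure_minimal) (force, simp)
    then show "compact (closure {x. frechet_derivative f (at x) i \<noteq> 0})"
      using S by (meson closed_closure compact_Int_closed compact_closure bounded_subset compact_imp_bounded closure_subset order_trans)
  qed (use Ck2 i in auto)
  then obtain A where A: "\<And>i. i \<in> Basis \<Longrightarrow> bl (A i) (\<lambda>x. frechet_derivative f (at x) i)" by metis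
  define B where "B = A0 + (\<Sum>i\<in>Basis. A i)"
  have A_nonneg: "0 \<le> A i" if "i \<in> Basis" for i using bl_nonneg[OF A[OF that]] .
  show ?thesis
  proof (rule that[of B])
    show "bl B f" using A_nonneg by (intro bl_mono[OF A0]) (simp add: B_def sum_nonneg)
    fix i :: 'a assume i: "i \<in> Basis"
    have "A i \<le> (\<Sum>i\<in>Basis. A i)" using A_nonneg i by (intro member_le_sum) auto
    then show "bl B (\<lambda>x. frechet_derivative f (at x) i)"
      using bl_nonneg[OF A0] by (intro bl_mono[OF A[OF i]]) (simp add: B_def)
  qed
qed

lemma Cc_inf_derivative:
  fixes f :: "'a::euclidean_space \<Rightarrow> real"
  assumes "Cc_inf f" shows "(f has_derivative frechet_derivative f (at x)) (at x)"
proof (rule frechet_derivative_at_differentiable)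
  have "Ck (Suc 0) f" using assms unfolding Cc_inf_def by blast
  then show "f differentiable_on UNIV" by simp
qed

text \<open>The mean value inequality for \<open>y \<mapsto> f y - D f(x) y\<close> on the ball of
  radius \<open>norm w\<close> about \<open>x\<close>, where the derivative is
  \<open>O(norm w)\<close> because the partial derivatives are Lipschitz.\<close>

lemma Cc_inf_taylor:
  fixes f :: "'a::euclidean_space \<Rightarrow> real"
  assumes f: "Cc_inf f"
  obtains C where "0 \<le> C" "\<And>x w. \<bar>f (x + w) - f x - frechet_derivative f (at x) w\<bar> \<le> C * (norm w)\<^sup>2"
proof -
  obtain A where A: "\<And>i. i \<in> Basis \<Longrightarrow> bl A (\<lambda>x. frechet_derivative f (at x) i)"
    by (rule Cc_inf_bl[OF f]) blast
  have A0: "0 \<le> A" using bl_nonneg[OF A[OF SOME_Basis]] .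
  let ?D = "\<lambda>x. frechet_derivative f (at x)"
  have der: "(f has_derivative ?D x) (at x)" for x using Cc_inf_derivative[OF f] .
  have lin: "linear (?D x)" for x using has_derivative_linear[OF der] .
  show ?thesis
  proof (rule that[of "DIM('a) * A"])
    show "0 \<le> DIM('a) * A" using A0 by simp
    fix x w :: 'a
    let ?g = "\<lambda>y. f y - ?D x y"
    have blx: "bounded_linear (?D x)" using der has_derivative_bounded_linear by blast
    have gd: "(?g has_derivative (\<lambda>v. ?D y v - ?D x v)) (at y within S)" for y S
      using has_derivative_diff[OF has_derivative_at_withinI[OF der] bounded_linear_imp_has_derivative[OF blx]]
      by blast
    have on: "onorm (\<lambda>v. ?D y v - ?D x v) \<le> DIM('a) * A * norm w" if y: "y \<in> cball x (norm w)" for y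
    proof (rule onorm_bound)
      show "0 \<le> DIM('a) * A * norm w" using A0 by simp
      fix v
      have "\<bar>?D y i - ?D x i\<bar> \<le> A * norm w" if "i \<in> Basis" for i
      proof -
        have "\<bar>?D y i - ?D x i\<bar> \<le> A * dist y x" using bl_lip[OF A[OF that]] .
        also have "\<dots> \<le> A * norm w" using y A0 by (intro mult_left_mono) (auto simp: dist_commute)
        finally show ?thesis .
      qed
      then show "norm (?D y v - ?D x v) \<le> DIM('a) * A * norm w * norm v"
        using linear_abs_le_Basis[OF linear_compose_sub[OF lin lin], of y x "A * norm w" v]
        by (simp add: mult_ac)
    qed
    have "norm (?g (x + w) - ?g x) \<le> DIM('a) * A * norm w * norm (x + w - x)"
      by (rule differentiable_bound[OF convex_cball gd on]) (auto simp: dist_norm)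
    then show "\<bar>f (x + w) - f x - ?D x w\<bar> \<le> DIM('a) * A * (norm w)\<^sup>2"
      using linear_add[OF lin, of x x w] by (simp add: power2_eq_square mult_ac algebra_simps)
  qed
qed

text \<open>\<open>1 \<le> L\<close> lets \<open>A * L\<close> dominate the supremum as
  well.\<close>

lemma bl_comp_lipschitz:
  assumes f: "bl A f" and g: "\<And>x y. dist (g x) (g y) \<le> L * dist x y" and L: "1 \<le> L"
  shows "bl (A * L) (\<lambda>x. f (g x))"
  unfolding bl_def
proof (intro conjI allI)
  fix x y
  have A: "0 \<le> A" using bl_nonneg[OF f] .
  show "\<bar>f (g x)\<bar> \<le> A * L"
    using bl_bound[OF f, of "g x"] mult_left_mono[OF L A] by simp
  have "\<bar>f (g x) - f (g y)\<bar> \<le> A * dist (g x) (g y)" using bl_lip[OF f] .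
  also have "\<dots> \<le> A * (L * dist x y)" using g A by (intro mult_left_mono)
  finally show "\<bar>f (g x) - f (g y)\<bar> \<le> A * L * dist x y" by (simp add: mult.assoc)
qed

lemma bl_fst: "bl A f \<Longrightarrow> bl A (\<lambda>p. f (fst p))"
  using bl_comp_lipschitz[of A f fst 1] by (simp add: dist_fst_le)

text \<open>The integrand of the transport term is linear in \<open>v\<close>, hence in general not
  bounded, and flat bounds do not apply to it. Clamping the coordinates of \<open>v\<close> to
  \<open>[-R, R]\<close> makes it bounded Lipschitz without changing it where
  \<open>norm v \<le> R\<close>.\<close>

lemma Cc_inf_gradient_bl:
  fixes f :: "'a::euclidean_space \<Rightarrow> real"
  assumes f: "Cc_inf f" and R: "0 \<le> R"
  obtains B G where "bl B G" "\<And>x v. norm v \<le> R \<Longrightarrow> G (x, v) = frechet_derivative f (at x) v"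
proof -
  obtain A where A: "\<And>i. i \<in> Basis \<Longrightarrow> bl A (\<lambda>x. frechet_derivative f (at x) i)"
    by (rule Cc_inf_bl[OF f]) blast
  define t where "t u = max (- R) (min R u)" for u :: real
  have t: "bl (R + 1) t"
    unfolding bl_def
  proof (intro conjI allI)
    fix u w :: real
    show "\<bar>t u\<bar> \<le> R + 1" using R by (auto simp: t_def)
    have "\<bar>t u - t w\<bar> \<le> \<bar>u - w\<bar>" by (auto simp: t_def max_def min_def)
    also have "\<dots> \<le> (R + 1) * dist u w" using R by (simp add: dist_real_def distrib_right)
    finally show "\<bar>t u - t w\<bar> \<le> (R + 1) * dist u w" .
  qed
  define G where "G p = (\<Sum>i\<in>Basis. t (snd p \<bullet> i) * frechet_derivative f (at (fst p)) i)" for p :: "'a \<times> 'a"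
  have "\<exists>B. bl B (\<lambda>p::'a \<times> 'a. t (snd p \<bullet> i) * frechet_derivative f (at (fst p)) i)" if i: "i \<in> Basis" for i
  proof -
    have "dist (snd p \<bullet> i) (snd q \<bullet> i) \<le> 1 * dist p q" for p q :: "'a \<times> 'a"
    proof -
      have "dist (snd p \<bullet> i) (snd q \<bullet> i) \<le> norm (snd p - snd q)"
        using Basis_le_norm[OF i, of "snd p - snd q"] by (simp add: dist_real_def inner_diff_left)
      also have "\<dots> \<le> dist p q" using dist_snd_le[of p q] by (simp add: dist_norm)
      finally show ?thesis by simp
    qed
    then have "bl ((R + 1) * 1) (\<lambda>p::'a \<times> 'a. t (snd p \<bullet> i))"
      by (intro bl_comp_lipschitz[OF t]) auto
    from bl_mult[OF this bl_fst[OF A[OF i]]] show ?thesis by blast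
  qed
  then have "\<exists>B. bl B G" unfolding G_def by (rule bl_sum)
  then obtain B where "bl B G" ..
  moreover have "G (x, v) = frechet_derivative f (at x) v" if v: "norm v \<le> R" for x v
  proof -
    have "t (v \<bullet> i) = v \<bullet> i" if "i \<in> Basis" for i
      using Basis_le_norm[OF that, of v] v by (auto simp: t_def)
    then show ?thesis
      unfolding G_def using linear_eq_sum_Basis[OF has_derivative_linear[OF Cc_inf_derivative[OF f]], of x v]
      by simp
  qed
  ultimately show ?thesis using that by blast
qed

subsection \<open>The explicit Euler scheme\<close>

text \<open>The constants of (V), (S) and (C) are fixed, with nonnegative Lipschitz constants. (V1)
  speaks of any bound \<open>R\<close> of \<open>norm x\<close> on the support instead of a
  supremum, and so claims nothing when the support is unbounded.\<close>

locale mde =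
  fixes V :: "'a::euclidean_space measure \<Rightarrow> ('a \<times> 'a) measure"
    and s :: "'a measure \<Rightarrow> 'a measure"
    and c :: "'a \<Rightarrow> 'a measure \<Rightarrow> real"
    and \<mu>0 :: "'a measure"
    and CS L Rs Cb CL :: real
  assumes V_fin: "fin_meas \<mu> \<Longrightarrow> fin_meas (V \<mu>)"
    and V_marg: "fin_meas \<mu> \<Longrightarrow> distr (V \<mu>) borel fst = \<mu>"
    and CS: "0 < CS"
    and V1: "fin_meas \<mu> \<Longrightarrow> \<forall>(x,v)\<in>supp (V \<mu>). norm x \<le> R \<Longrightarrow> (x, v) \<in> supp (V \<mu>) \<Longrightarrow> norm v \<le> CS * (1 + R)"
    and V2: "0 < R \<Longrightarrow> \<exists>CF\<ge>0. \<forall>\<mu> \<nu>. fin_meas \<mu> \<and> fin_meas \<nu> \<and> supp \<mu> \<subseteq> cball 0 R \<and> supp \<nu> \<subseteq> cball 0 R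
              \<longrightarrow> flat (V \<mu>) (V \<nu>) \<le> CF * flat \<mu> \<nu>"
    and S_fin: "fin_meas \<mu> \<Longrightarrow> fin_meas (s \<mu>)"
    and L: "0 \<le> L"
    and S1: "fin_meas \<mu> \<Longrightarrow> fin_meas \<nu> \<Longrightarrow> flat (s \<mu>) (s \<nu>) \<le> L * flat \<mu> \<nu>"
    and S2: "fin_meas \<mu> \<Longrightarrow> supp (s \<mu>) \<subseteq> cball 0 Rs"
    and Cb: "0 < Cb" and C1: "fin_meas \<mu> \<Longrightarrow> \<bar>c x \<mu>\<bar> \<le> Cb"
    and CL: "0 < CL"
    and C2: "fin_meas \<mu> \<Longrightarrow> fin_meas \<nu> \<Longrightarrow> \<bar>c x \<mu> - c y \<nu>\<bar> \<le> CL * (norm (x - y) + flat \<mu> \<nu>)"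
    and mu0: "fin_meas \<mu>0"
begin

section \<open>Consequences of (V), (S) and (C) for a single measure\<close>

lemma bl_c: "fin_meas \<mu> \<Longrightarrow> bl (Cb + CL) (\<lambda>x. c x \<mu>)"
  unfolding bl_def
proof (intro conjI allI)
  fix x y assume \<mu>: "fin_meas \<mu>"
  show "\<bar>c x \<mu>\<bar> \<le> Cb + CL" using C1[OF \<mu>, of x] CL by linarith
  have "\<bar>c x \<mu> - c y \<mu>\<bar> \<le> CL * (norm (x - y) + flat \<mu> \<mu>)" using C2[OF \<mu> \<mu>] .
  also have "\<dots> \<le> CL * norm (x - y)" using CL flat_self[of \<mu>] by (intro mult_left_mono) auto
  also have "\<dots> \<le> (Cb + CL) * dist x y" using Cb by (simp add: dist_norm distrib_right)
  finally show "\<bar>c x \<mu> - c y \<mu>\<bar> \<le> (Cb + CL) * dist x y" .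
qed

lemma fst_measurable_V: "fin_meas \<mu> \<Longrightarrow> fst \<in> measurable (V \<mu>) borel"
  by (simp add: fin_measD(4)[OF V_fin] borel_measurable_continuous_onI continuous_on_fst continuous_on_id)

lemma integral_V_fst:
  fixes f :: "'a \<Rightarrow> real"
  assumes "fin_meas \<mu>" "f \<in> borel_measurable borel"
  shows "(\<integral>p. f (fst p) \<partial>V \<mu>) = (\<integral>x. f x \<partial>\<mu>)"
  using integral_distr[OF fst_measurable_V[OF assms(1)] assms(2)] V_marg[OF assms(1)] by simp

lemma mass_V:
  assumes "fin_meas \<mu>" shows "measure (V \<mu>) UNIV = measure \<mu> UNIV"
  using integral_V_fst[OF assms, of "\<lambda>_. 1"] assms by (simp add: fin_measD(2)[OF V_fin] fin_measD(2))

text \<open>The marginal condition bounds \<open>x\<close> almost everywhere; closedness carries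
  this to the support, where (V1) applies, and the velocity bound is carried back.\<close>

lemma AE_V:
  assumes \<mu>: "fin_meas \<mu>" and AE: "AE x in \<mu>. norm x \<le> \<rho>"
  shows "AE p in V \<mu>. norm (fst p) \<le> \<rho> \<and> norm (snd p) \<le> CS * (1 + \<rho>)"
proof -
  have 1: "AE p in V \<mu>. norm (fst p) \<le> \<rho>"
    by (rule AE_distrD[OF fst_measurable_V[OF \<mu>]]) (simp only: V_marg[OF \<mu>] AE)
  have "closed {p :: 'a \<times> 'a. norm (fst p) \<le> \<rho>}"
    by (intro closed_Collect_le continuous_intros)
  then have "supp (V \<mu>) \<subseteq> {p. norm (fst p) \<le> \<rho>}"
    using 1 supp_subset_iff[OF V_fin[OF \<mu>]] by simp
  then have *: "\<forall>(x,v)\<in>supp (V \<mu>). norm x \<le> \<rho>" by auto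
  have "closed {p :: 'a \<times> 'a. norm (snd p) \<le> CS * (1 + \<rho>)}"
    by (intro closed_Collect_le continuous_intros)
  moreover have "supp (V \<mu>) \<subseteq> {p. norm (snd p) \<le> CS * (1 + \<rho>)}"
    using V1[OF \<mu> *] by auto
  ultimately have "AE p in V \<mu>. norm (snd p) \<le> CS * (1 + \<rho>)"
    using supp_subset_iff[OF V_fin[OF \<mu>]] by simp
  with 1 show ?thesis by eventually_elim simp
qed

lemma AE_s: "fin_meas \<mu> \<Longrightarrow> AE x in s \<mu>. norm x \<le> Rs"
  using supp_subset_iff[OF S_fin, of \<mu> "cball 0 Rs"] S2 by simp

text \<open>(S1) controls only differences of sources, so \<open>\<mu>0\<close> serves as a
  reference point. The resulting bound is affine in the mass, as a Gronwall argument needs.\<close>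

lemma mass_s:
  assumes "fin_meas \<mu>"
  shows "measure (s \<mu>) UNIV \<le> measure (s \<mu>0) UNIV + L * (measure \<mu> UNIV + measure \<mu>0 UNIV)"
proof -
  have "measure (s \<mu>) UNIV - measure (s \<mu>0) UNIV \<le> flat (s \<mu>) (s \<mu>0)"
    using mass_diff_le_flat[OF S_fin[OF assms] S_fin[OF mu0]] by linarith
  also have "\<dots> \<le> L * flat \<mu> \<mu>0" using S1[OF assms mu0] .
  also have "\<dots> \<le> L * (measure \<mu> UNIV + measure \<mu>0 UNIV)"
    by (intro mult_left_mono flat_le_mass assms mu0 L)
  finally show ?thesis by simp
qed

text \<open>A relation that prescribes only integrals of bounded Lipschitz functions; a measure
  satisfying it comes from the Riesz theorem. Supports are tracked separately.\<close>

definition is_step :: "real \<Rightarrow> 'a measure \<Rightarrow> 'a measure \<Rightarrow> bool" where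
  "is_step h \<mu> \<nu> \<longleftrightarrow> fin_meas \<nu> \<and> (\<forall>A f. bl A f \<longrightarrow> (\<integral>x. f x \<partial>\<nu>) =
     (\<integral>p. (1 + h * c (fst p) \<mu>) * f (fst p + h *\<^sub>R snd p) \<partial>V \<mu>) + h * (\<integral>x. f x \<partial>s \<mu>))"

lemma bl_shift:
  assumes "bl A (f :: 'a \<Rightarrow> real)" "0 \<le> h"
  shows "bl (A * (1 + h)) (\<lambda>p. f (fst p + h *\<^sub>R snd p))"
proof (rule bl_comp_lipschitz[OF assms(1)])
  fix p q :: "'a \<times> 'a"
  have "dist (fst p + h *\<^sub>R snd p) (fst q + h *\<^sub>R snd q) = norm ((fst p - fst q) + h *\<^sub>R (snd p - snd q))"
    by (simp add: dist_norm algebra_simps)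
  also have "\<dots> \<le> dist (fst p) (fst q) + h * dist (snd p) (snd q)"
    using assms(2) norm_triangle_ineq[of "fst p - fst q" "h *\<^sub>R (snd p - snd q)"] by (simp add: dist_norm)
  also have "\<dots> \<le> dist p q + h * dist p q"
    using assms(2) by (intro add_mono mult_left_mono dist_fst_le dist_snd_le)
  finally show "dist (fst p + h *\<^sub>R snd p) (fst q + h *\<^sub>R snd q) \<le> (1 + h) * dist p q"
    by (simp add: distrib_right)
qed (use assms in simp)

lemma bl_weight:
  assumes "fin_meas \<mu>" shows "bl (\<bar>1\<bar> + \<bar>h\<bar> * (Cb + CL)) (\<lambda>p::'a \<times> 'a. 1 + h * c (fst p) \<mu>)"
  by (intro bl_add bl_const bl_cmult bl_fst bl_c assms)

text \<open>\<open>h * Cb \<le> 1\<close> keeps the growth weight nonnegative, so the functional is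
  positive. The new radius is the farthest a point can move in time \<open>h\<close>, and
  \<open>Rs \<le> \<rho>\<close> keeps the source inside it.\<close>

lemma step_exists:
  assumes \<mu>: "fin_meas \<mu>" and AE: "AE x in \<mu>. norm x \<le> \<rho>" and \<rho>: "Rs \<le> \<rho>" "0 \<le> \<rho>"
    and h: "0 \<le> h" "h * Cb \<le> 1"
  shows "\<exists>\<nu>. is_step h \<mu> \<nu> \<and> (AE x in \<nu>. norm x \<le> \<rho> + h * (CS * (1 + \<rho>)))"
proof -
  let ?\<rho> = "\<rho> + h * (CS * (1 + \<rho>))"
  define \<Lambda> where "\<Lambda> f = (\<integral>p. (1 + h * c (fst p) \<mu>) * f (fst p + h *\<^sub>R snd p) \<partial>V \<mu>) + h * (\<integral>x. f x \<partial>s \<mu>)"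
    for f :: "'a \<Rightarrow> real"
  have iV: "integrable (V \<mu>) (\<lambda>p. (1 + h * c (fst p) \<mu>) * f (fst p + h *\<^sub>R snd p))" if "bl A f" for A f
    by (rule bl_integrable[OF V_fin[OF \<mu>] bl_mult[OF bl_weight[OF \<mu>] bl_shift[OF that h(1)]]])
  have iS: "integrable (s \<mu>) f" if "bl A f" for A f
    by (rule bl_integrable[OF S_fin[OF \<mu>] that])
  interpret bl_functional \<Lambda> "cball 0 ?\<rho>"
  proof
    fix A B f g assume f: "bl A (f :: 'a \<Rightarrow> real)" and g: "bl B (g :: 'a \<Rightarrow> real)"
    show "\<Lambda> (\<lambda>x. f x + g x) = \<Lambda> f + \<Lambda> g"
      unfolding \<Lambda>_def distrib_left
      using iV[OF f] iV[OF g] iS[OF f] iS[OF g] by (simp add: distrib_left)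
  next
    fix A a f assume f: "bl A (f :: 'a \<Rightarrow> real)"
    have "(\<integral>p. (1 + h * c (fst p) \<mu>) * (a * f (fst p + h *\<^sub>R snd p)) \<partial>V \<mu>)
        = a * (\<integral>p. (1 + h * c (fst p) \<mu>) * f (fst p + h *\<^sub>R snd p) \<partial>V \<mu>)"
      by (subst integral_mult_right_zero[symmetric]) (simp add: mult_ac)
    then show "\<Lambda> (\<lambda>x. a * f x) = a * \<Lambda> f"
      unfolding \<Lambda>_def by (simp add: algebra_simps)
  next
    fix A f assume f: "bl A (f :: 'a \<Rightarrow> real)" "\<And>x. x \<in> cball 0 ?\<rho> \<Longrightarrow> 0 \<le> f x"
    have "0 \<le> (\<integral>p. (1 + h * c (fst p) \<mu>) * f (fst p + h *\<^sub>R snd p) \<partial>V \<mu>)"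
    proof (rule integral_nonneg_AE, use AE_V[OF \<mu> AE] in eventually_elim)
      fix p :: "'a \<times> 'a" assume p: "norm (fst p) \<le> \<rho> \<and> norm (snd p) \<le> CS * (1 + \<rho>)"
      have "norm (fst p + h *\<^sub>R snd p) \<le> norm (fst p) + h * norm (snd p)"
        using norm_triangle_ineq[of "fst p" "h *\<^sub>R snd p"] h by simp
      also have "\<dots> \<le> ?\<rho>" using p h by (intro add_mono mult_left_mono) auto
      finally have "0 \<le> f (fst p + h *\<^sub>R snd p)" using f(2) by simp
      moreover have "0 \<le> 1 + h * c (fst p) \<mu>"
      proof -
        have "\<bar>h * c (fst p) \<mu>\<bar> \<le> h * Cb"
          unfolding abs_mult using h C1[OF \<mu>] by (intro mult_mono) auto
        then show ?thesis using h(2) by linarith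
      qed
      ultimately show "0 \<le> (1 + h * c (fst p) \<mu>) * f (fst p + h *\<^sub>R snd p)" by simp
    qed
    moreover have "0 \<le> (\<integral>x. f x \<partial>s \<mu>)"
    proof (rule integral_nonneg_AE, use AE_s[OF \<mu>] in eventually_elim)
      fix x :: 'a assume "norm x \<le> Rs"
      moreover have "0 \<le> h * (CS * (1 + \<rho>))" using h \<rho> CS by simp
      ultimately show "0 \<le> f x" using f(2)[of x] \<rho> by simp
    qed
    ultimately show "0 \<le> \<Lambda> f" using h by (simp add: \<Lambda>_def)
  qed simp
  have "is_step h \<mu> riesz_measure"
    unfolding is_step_def using fin_meas_riesz integral_riesz \<Lambda>_def by metis
  moreover have "AE x in riesz_measure. norm x \<le> ?\<rho>" using AE_riesz by simp
  ultimately show ?thesis by blast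
qed

lemma mass_step:
  assumes \<mu>: "fin_meas \<mu>" and st: "is_step h \<mu> \<nu>" and h: "0 \<le> h"
  shows "measure \<nu> UNIV \<le> measure \<mu> UNIV + h * (Cb * measure \<mu> UNIV + measure (s \<mu>) UNIV)"
proof -
  have \<nu>: "fin_meas \<nu>" using st by (simp add: is_step_def)
  have "measure \<nu> UNIV = (\<integral>x. 1 \<partial>\<nu>)" by (simp add: fin_measD(2)[OF \<nu>])
  also have "\<dots> = (\<integral>p. (1 + h * c (fst p) \<mu>) * 1 \<partial>V \<mu>) + h * (\<integral>x. 1 \<partial>s \<mu>)"
    using st bl_const[of 1] unfolding is_step_def by blast
  also have "(\<integral>p. (1 + h * c (fst p) \<mu>) * 1 \<partial>V \<mu>) \<le> (1 + h * Cb) * measure (V \<mu>) UNIV"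
  proof (rule order_trans[OF abs_ge_self integral_abs_le_mass[OF V_fin[OF \<mu>]]])
    show "AE p in V \<mu>. \<bar>(1 + h * c (fst p) \<mu>) * 1\<bar> \<le> 1 + h * Cb"
    proof (rule AE_I2)
      fix p :: "'a \<times> 'a"
      have "\<bar>h * c (fst p) \<mu>\<bar> \<le> h * Cb"
        unfolding abs_mult using h C1[OF \<mu>] by (intro mult_mono) auto
      then show "\<bar>(1 + h * c (fst p) \<mu>) * 1\<bar> \<le> 1 + h * Cb" by (simp add: abs_le_iff)
    qed
    show "0 \<le> 1 + h * Cb" using h Cb by simp
  qed
  finally show ?thesis
    using mass_V[OF \<mu>] by (simp add: fin_measD(2)[OF S_fin[OF \<mu>]] algebra_simps)
qed

definition admissible :: "real \<Rightarrow> real \<Rightarrow> 'a measure \<Rightarrow> bool" where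
  "admissible R m \<mu> \<longleftrightarrow> fin_meas \<mu> \<and> (AE x in \<mu>. norm x \<le> R) \<and> measure \<mu> UNIV \<le> m"

lemma mass_s_admissible:
  assumes "admissible R m \<mu>"
  shows "measure (s \<mu>) UNIV \<le> measure (s \<mu>0) UNIV + L * (m + measure \<mu>0 UNIV)"
proof -
  have "L * (measure \<mu> UNIV + measure \<mu>0 UNIV) \<le> L * (m + measure \<mu>0 UNIV)"
    using assms L by (intro mult_left_mono) (auto simp: admissible_def)
  then show ?thesis using mass_s[of \<mu>] assms by (auto simp: admissible_def)
qed

text \<open>Against a function in the unit ball, transport with speed at most \<open>W\<close>
  contributes \<open>h * W\<close> and growth \<open>h * Cb\<close>, each times the mass; the source
  contributes \<open>h\<close> times its mass bound \<open>S\<close>.\<close>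

lemma flat_step:
  assumes "0 \<le> R" "0 \<le> m"
  obtains C where "0 \<le> C"
    "\<And>h \<mu> \<nu>. 0 \<le> h \<Longrightarrow> admissible R m \<mu> \<Longrightarrow> is_step h \<mu> \<nu> \<Longrightarrow> flat \<mu> \<nu> \<le> C * h"
proof -
  define S where "S = measure (s \<mu>0) UNIV + L * (m + measure \<mu>0 UNIV)"
  define W where "W = CS * (1 + R)"
  have W: "0 \<le> W" using assms CS by (simp add: W_def)
  show ?thesis
  proof (rule that[of "(W + Cb) * m + S"])
    have "0 \<le> S" using assms L by (simp add: S_def)
    then show "0 \<le> (W + Cb) * m + S" using W Cb assms by simp
    fix h \<mu> \<nu> assume h: "0 \<le> h" and adm: "admissible R m \<mu>" and st: "is_step h \<mu> \<nu>"
    have \<mu>: "fin_meas \<mu>" and AE: "AE x in \<mu>. norm x \<le> R" and m: "measure \<mu> UNIV \<le> m"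
      using adm by (auto simp: admissible_def)
    have \<nu>: "fin_meas \<nu>" using st by (simp add: is_step_def)
    have "flat \<nu> \<mu> \<le> ((W + Cb) * m + S) * h"
    proof (rule flat_le)
      fix f :: "'a \<Rightarrow> real" assume f: "bl 1 f"
      let ?A = "\<lambda>p. (1 + h * c (fst p) \<mu>) * f (fst p + h *\<^sub>R snd p)"
      have iA: "integrable (V \<mu>) ?A"
        by (rule bl_integrable[OF V_fin[OF \<mu>] bl_mult[OF bl_weight[OF \<mu>] bl_shift[OF f h]]])
      have iF: "integrable (V \<mu>) (\<lambda>p. f (fst p))"
        by (rule bl_integrable[OF V_fin[OF \<mu>] bl_fst[OF f]])
      have "(\<integral>x. f x \<partial>\<nu>) - (\<integral>x. f x \<partial>\<mu>) = (\<integral>p. ?A p \<partial>V \<mu>) + h * (\<integral>x. f x \<partial>s \<mu>) - (\<integral>p. f (fst p) \<partial>V \<mu>)"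
      proof -
        have "(\<integral>x. f x \<partial>\<nu>) = (\<integral>p. ?A p \<partial>V \<mu>) + h * (\<integral>x. f x \<partial>s \<mu>)"
          using st f unfolding is_step_def by blast
        then show ?thesis using integral_V_fst[OF \<mu> bl_measurable[OF f]] by simp
      qed
      also have "\<dots> = (\<integral>p. ?A p - f (fst p) \<partial>V \<mu>) + h * (\<integral>x. f x \<partial>s \<mu>)"
        using iA iF by simp
      also have "(\<integral>p. ?A p - f (fst p) \<partial>V \<mu>) \<le> (h * (W + Cb)) * measure (V \<mu>) UNIV"
      proof (rule order_trans[OF abs_ge_self integral_abs_le_mass[OF V_fin[OF \<mu>]]])
        show "AE p in V \<mu>. \<bar>?A p - f (fst p)\<bar> \<le> h * (W + Cb)"
          using AE_V[OF \<mu> AE]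
        proof eventually_elim
          fix p :: "'a \<times> 'a" assume p: "norm (fst p) \<le> R \<and> norm (snd p) \<le> CS * (1 + R)"
          have "\<bar>f (fst p + h *\<^sub>R snd p) - f (fst p)\<bar> \<le> h * norm (snd p)"
            using bl_lip[OF f, of "fst p + h *\<^sub>R snd p" "fst p"] h by (simp add: dist_norm)
          also have "\<dots> \<le> h * W" using p h by (intro mult_left_mono) (auto simp: W_def)
          finally have 1: "\<bar>f (fst p + h *\<^sub>R snd p) - f (fst p)\<bar> \<le> h * W" .
          have "\<bar>h * c (fst p) \<mu> * f (fst p + h *\<^sub>R snd p)\<bar> \<le> (h * Cb) * 1"
            unfolding abs_mult using h C1[OF \<mu>] bl_bound[OF f] Cb by (intro mult_mono) auto
          moreover have "?A p - f (fst p) = (f (fst p + h *\<^sub>R snd p) - f (fst p)) + h * c (fst p) \<mu> * f (fst p + h *\<^sub>R snd p)"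
            by (simp add: algebra_simps)
          ultimately show "\<bar>?A p - f (fst p)\<bar> \<le> h * (W + Cb)" using 1 unfolding distrib_left[of h] by linarith
        qed
        show "0 \<le> h * (W + Cb)" using h W Cb by simp
      qed
      also have "\<dots> \<le> (h * (W + Cb)) * m"
        unfolding mass_V[OF \<mu>] using h W Cb m by (intro mult_left_mono) auto
      also have "h * (\<integral>x. f x \<partial>s \<mu>) \<le> h * S"
        using bl_integral_abs_le[OF S_fin[OF \<mu>] f] mass_s_admissible[OF adm] h
        by (intro mult_left_mono) (auto simp: S_def)
      finally show "(\<integral>x. f x \<partial>\<nu>) - (\<integral>x. f x \<partial>\<mu>) \<le> ((W + Cb) * m + S) * h"
        by (simp add: algebra_simps)
    qed
    then show "flat \<mu> \<nu> \<le> ((W + Cb) * m + S) * h" using flat_sym[OF \<mu> \<nu>] by simp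
  qed
qed

section \<open>The right-hand side of the weak formulation: flat-Lipschitz bounds and
  consistency\<close>

definition drift :: "('a \<Rightarrow> real) \<Rightarrow> 'a measure \<Rightarrow> real" where
  "drift f \<mu> = (\<integral>(x,v). frechet_derivative f (at x) v \<partial>V \<mu>)"

definition growth :: "('a \<Rightarrow> real) \<Rightarrow> 'a measure \<Rightarrow> real" where
  "growth f \<mu> = (\<integral>x. f x * c x \<mu> \<partial>\<mu>)"

definition source :: "('a \<Rightarrow> real) \<Rightarrow> 'a measure \<Rightarrow> real" where
  "source f \<mu> = (\<integral>x. f x \<partial>s \<mu>)"

text \<open>The same clamped gradient \<open>G\<close> works for every measure carried by the ball
  of radius \<open>R\<close>, which is what makes two measures comparable.\<close>

lemma drift_eq:
  assumes f: "Cc_inf f" and R: "0 \<le> R"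
  obtains B G where "bl B G"
    "\<And>\<mu>. fin_meas \<mu> \<Longrightarrow> AE x in \<mu>. norm x \<le> R \<Longrightarrow>
      integrable (V \<mu>) (\<lambda>(x,v). frechet_derivative f (at x) v) \<and> drift f \<mu> = (\<integral>p. G p \<partial>V \<mu>)"
    "\<And>p. norm (snd p) \<le> CS * (1 + R) \<Longrightarrow> G p = frechet_derivative f (at (fst p)) (snd p)"
proof -
  have R': "0 \<le> CS * (1 + R)" using R CS by simp
  obtain B G where G: "bl B G" "\<And>x v. norm v \<le> CS * (1 + R) \<Longrightarrow> G (x, v) = frechet_derivative f (at x) v"
    by (rule Cc_inf_gradient_bl[OF f R']) blast
  obtain A where A: "\<And>i. i \<in> Basis \<Longrightarrow> bl A (\<lambda>x. frechet_derivative f (at x) i)"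
    by (rule Cc_inf_bl[OF f]) blast
  \<comment> \<open>The unclamped integrand must be shown Borel on its own before almost-everywhere
    equality with \<open>G\<close> can transfer integrability; in coordinates it is visibly
    continuous.\<close>
  have cont: "continuous_on UNIV (\<lambda>p::'a \<times> 'a. \<Sum>i\<in>Basis. (snd p \<bullet> i) * frechet_derivative f (at (fst p)) i)"
    by (intro continuous_intros bl_continuous_on[OF bl_fst[OF A]]) auto
  have sum: "(\<lambda>p. \<Sum>i\<in>Basis. (snd p \<bullet> i) * frechet_derivative f (at (fst p)) i)
      = (\<lambda>(x,v). frechet_derivative f (at x) v)"
    unfolding case_prod_beta
    by (rule ext, rule linear_eq_sum_Basis[OF has_derivative_linear[OF Cc_inf_derivative[OF f]], symmetric])
  have meas: "(\<lambda>(x,v). frechet_derivative f (at x) v) \<in> borel_measurable borel"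
    using borel_measurable_continuous_onI[OF cont] unfolding sum .
  show ?thesis
  proof (rule that[OF G(1)])
    fix p :: "'a \<times> 'a" assume "norm (snd p) \<le> CS * (1 + R)"
    then show "G p = frechet_derivative f (at (fst p)) (snd p)" using G(2)[of "snd p" "fst p"] by simp
  next
    fix \<mu> :: "'a measure" assume \<mu>: "fin_meas \<mu>" "AE x in \<mu>. norm x \<le> R"
    have eq: "AE p in V \<mu>. G p = (case p of (x, v) \<Rightarrow> frechet_derivative f (at x) v)"
      using AE_V[OF \<mu>] by eventually_elim (use G(2) in \<open>auto split: prod.splits\<close>)
    have m: "G \<in> borel_measurable (V \<mu>)" "(\<lambda>(x,v). frechet_derivative f (at x) v) \<in> borel_measurable (V \<mu>)"
      using meas bl_measurable[OF G(1)] by (simp_all add: fin_measD(4)[OF V_fin[OF \<mu>(1)]])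
    have "integrable (V \<mu>) G" by (rule bl_integrable[OF V_fin[OF \<mu>(1)] G(1)])
    then have "integrable (V \<mu>) (\<lambda>(x,v). frechet_derivative f (at x) v)"
      using integrable_cong_AE[OF m eq] by simp
    moreover have "drift f \<mu> = (\<integral>p. G p \<partial>V \<mu>)"
      unfolding drift_def using integral_cong_AE[OF m eq] by simp
    ultimately show "integrable (V \<mu>) (\<lambda>(x,v). frechet_derivative f (at x) v) \<and> drift f \<mu> = (\<integral>p. G p \<partial>V \<mu>)" ..
  qed
qed

text \<open>(V2) enters here, tested against the clamped gradient.\<close>

lemma drift_lipschitz:
  assumes f: "Cc_inf f" and R: "0 < R"
  obtains C where "0 \<le> C" "\<And>\<mu> \<nu>. admissible R m \<mu> \<Longrightarrow> admissible R m \<nu> \<Longrightarrow>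
    \<bar>drift f \<mu> - drift f \<nu>\<bar> \<le> C * flat \<mu> \<nu>"
proof -
  obtain B G where G: "bl B G" "\<And>\<mu>. fin_meas \<mu> \<Longrightarrow> AE x in \<mu>. norm x \<le> R \<Longrightarrow>
      integrable (V \<mu>) (\<lambda>(x,v). frechet_derivative f (at x) v) \<and> drift f \<mu> = (\<integral>p. G p \<partial>V \<mu>)"
    by (rule drift_eq[OF f less_imp_le[OF R]]) blast
  obtain CF where CF: "0 \<le> CF" "\<And>\<mu> \<nu>. fin_meas \<mu> \<Longrightarrow> fin_meas \<nu> \<Longrightarrow> supp \<mu> \<subseteq> cball 0 R \<Longrightarrow>
      supp \<nu> \<subseteq> cball 0 R \<Longrightarrow> flat (V \<mu>) (V \<nu>) \<le> CF * flat \<mu> \<nu>"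
    using V2[OF R] by blast
  have B: "0 \<le> B" using bl_nonneg[OF G(1)] .
  show ?thesis
  proof (rule that[of "B * CF"])
    fix \<mu> \<nu> assume "admissible R m \<mu>" "admissible R m \<nu>"
    then have \<mu>: "fin_meas \<mu>" "AE x in \<mu>. norm x \<le> R" and \<nu>: "fin_meas \<nu>" "AE x in \<nu>. norm x \<le> R"
      by (auto simp: admissible_def)
    have "\<bar>drift f \<mu> - drift f \<nu>\<bar> \<le> B * flat (V \<mu>) (V \<nu>)"
      using G(2)[OF \<mu>] G(2)[OF \<nu>] bl_integral_diff_le[OF V_fin[OF \<mu>(1)] V_fin[OF \<nu>(1)] G(1)] by simp
    also have "\<dots> \<le> B * (CF * flat \<mu> \<nu>)"
      using CF(2)[OF \<mu>(1) \<nu>(1)] supp_subset_iff[OF \<mu>(1), of "cball 0 R"] supp_subset_iff[OF \<nu>(1), of "cball 0 R"] \<mu> \<nu> B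
      by (intro mult_left_mono) auto
    finally show "\<bar>drift f \<mu> - drift f \<nu>\<bar> \<le> B * CF * flat \<mu> \<nu>" by (simp add: mult.assoc)
  qed (use B CF in simp)
qed

text \<open>The measure occurs twice. First change the coefficient under a fixed measure, by (C2)
  and the mass bound; then change the measure under a fixed coefficient, where \<open>f\<close>
  times \<open>c\<close> is bounded Lipschitz.\<close>

lemma growth_lipschitz:
  assumes f: "bl A f" and m: "0 \<le> m"
  obtains C where "0 \<le> C" "\<And>\<mu> \<nu>. admissible R m \<mu> \<Longrightarrow> admissible R m \<nu> \<Longrightarrow>
    \<bar>growth f \<mu> - growth f \<nu>\<bar> \<le> C * flat \<mu> \<nu>"
proof -
  have A: "0 \<le> A" using bl_nonneg[OF f] .
  let ?B = "2 * A * (Cb + CL)"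
  show ?thesis
  proof (rule that[of "A * CL * m + ?B"])
    show "0 \<le> A * CL * m + ?B" using A CL Cb m by simp
    fix \<mu> \<nu> assume adm: "admissible R m \<mu>" "admissible R m \<nu>"
    then have \<mu>: "fin_meas \<mu>" and \<nu>: "fin_meas \<nu>" and mm: "measure \<mu> UNIV \<le> m" by (auto simp: admissible_def)
    have fl: "0 \<le> flat \<mu> \<nu>" using flat_nonneg[OF \<mu> \<nu>] .
    have b1: "bl ?B (\<lambda>x. f x * c x \<mu>)" and b2: "bl ?B (\<lambda>x. f x * c x \<nu>)"
      by (intro bl_mult f bl_c \<mu> \<nu>)+
    have "\<bar>\<integral>x. f x * c x \<mu> - f x * c x \<nu> \<partial>\<mu>\<bar> \<le> (A * (CL * flat \<mu> \<nu>)) * measure \<mu> UNIV"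
    proof (rule integral_abs_le_mass[OF \<mu> AE_I2])
      fix x
      have "\<bar>f x * (c x \<mu> - c x \<nu>)\<bar> \<le> A * (CL * flat \<mu> \<nu>)"
        unfolding abs_mult using bl_bound[OF f] C2[OF \<mu> \<nu>, of x x] A by (intro mult_mono) auto
      then show "\<bar>f x * c x \<mu> - f x * c x \<nu>\<bar> \<le> A * (CL * flat \<mu> \<nu>)" by (simp add: right_diff_distrib)
    qed (use A CL fl in simp)
    also have "\<dots> \<le> (A * (CL * flat \<mu> \<nu>)) * m" using A CL fl mm by (intro mult_left_mono) auto
    finally have 1: "\<bar>(\<integral>x. f x * c x \<mu> \<partial>\<mu>) - (\<integral>x. f x * c x \<nu> \<partial>\<mu>)\<bar> \<le> A * CL * m * flat \<mu> \<nu>"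
      using bl_integrable[OF \<mu> b1] bl_integrable[OF \<mu> b2] by (simp add: mult_ac)
    have 2: "\<bar>(\<integral>x. f x * c x \<nu> \<partial>\<mu>) - (\<integral>x. f x * c x \<nu> \<partial>\<nu>)\<bar> \<le> ?B * flat \<mu> \<nu>"
      by (rule bl_integral_diff_le[OF \<mu> \<nu> b2])
    show "\<bar>growth f \<mu> - growth f \<nu>\<bar> \<le> (A * CL * m + ?B) * flat \<mu> \<nu>"
      unfolding growth_def distrib_right[of _ _ "flat \<mu> \<nu>"] using 1 2 by linarith
  qed
qed

lemma source_lipschitz:
  assumes "bl A f" "fin_meas \<mu>" "fin_meas \<nu>"
  shows "\<bar>source f \<mu> - source f \<nu>\<bar> \<le> A * L * flat \<mu> \<nu>"
proof -
  have "\<bar>source f \<mu> - source f \<nu>\<bar> \<le> A * flat (s \<mu>) (s \<nu>)"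
    unfolding source_def by (rule bl_integral_diff_le[OF S_fin[OF assms(2)] S_fin[OF assms(3)] assms(1)])
  also have "\<dots> \<le> A * (L * flat \<mu> \<nu>)"
    using S1[OF assms(2,3)] bl_nonneg[OF assms(1)] by (intro mult_left_mono)
  finally show ?thesis by (simp add: mult.assoc)
qed

text \<open>The error splits into the Taylor remainder, at most \<open>C * (h * W)\<^sup>2\<close>,
  and \<open>h c (f(x + h v) - f(x))\<close>, at most \<open>h * Cb * (A * (h * W))\<close>: growth
  is weighted at the moved point in the scheme but at the old point in \<open>growth\<close>. The
  source term is exact.\<close>

lemma step_consistent:
  assumes f: "Cc_inf f" and R: "0 \<le> R" and m: "0 \<le> m"
  obtains C where "0 \<le> C" "\<And>h \<mu> \<nu>. 0 \<le> h \<Longrightarrow> admissible R m \<mu> \<Longrightarrow> is_step h \<mu> \<nu> \<Longrightarrow>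
    \<bar>(\<integral>x. f x \<partial>\<nu>) - (\<integral>x. f x \<partial>\<mu>) - h * (drift f \<mu> + growth f \<mu> + source f \<mu>)\<bar> \<le> C * h\<^sup>2"
proof -
  obtain A where A: "bl A f" by (rule Cc_inf_bl[OF f]) blast
  obtain C where C: "0 \<le> C" "\<And>x w. \<bar>f (x + w) - f x - frechet_derivative f (at x) w\<bar> \<le> C * (norm w)\<^sup>2"
    by (rule Cc_inf_taylor[OF f]) blast
  obtain B G where G: "bl B G" "\<And>\<mu>. fin_meas \<mu> \<Longrightarrow> AE x in \<mu>. norm x \<le> R \<Longrightarrow>
      integrable (V \<mu>) (\<lambda>(x,v). frechet_derivative f (at x) v) \<and> drift f \<mu> = (\<integral>p. G p \<partial>V \<mu>)"
    "\<And>p. norm (snd p) \<le> CS * (1 + R) \<Longrightarrow> G p = frechet_derivative f (at (fst p)) (snd p)"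
    by (rule drift_eq[OF f R]) blast
  have A0: "0 \<le> A" using bl_nonneg[OF A] .
  define W where "W = CS * (1 + R)"
  have W: "0 \<le> W" using R CS by (simp add: W_def)
  show ?thesis
  proof (rule that[of "(C * W\<^sup>2 + Cb * (A * W)) * m"])
    show "0 \<le> (C * W\<^sup>2 + Cb * (A * W)) * m" using C W Cb A0 m by simp
    fix h \<mu> \<nu> assume h: "0 \<le> h" and adm: "admissible R m \<mu>" and st: "is_step h \<mu> \<nu>"
    have \<mu>: "fin_meas \<mu>" and AE: "AE x in \<mu>. norm x \<le> R" and mm: "measure \<mu> UNIV \<le> m"
      using adm by (auto simp: admissible_def)
    let ?A = "\<lambda>p. (1 + h * c (fst p) \<mu>) * f (fst p + h *\<^sub>R snd p)"
    have bfc: "bl (2 * A * (Cb + CL)) (\<lambda>x. f x * c x \<mu>)" by (intro bl_mult A bl_c \<mu>)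
    have iA: "integrable (V \<mu>) ?A"
      by (rule bl_integrable[OF V_fin[OF \<mu>] bl_mult[OF bl_weight[OF \<mu>] bl_shift[OF A h]]])
    have iF: "integrable (V \<mu>) (\<lambda>p. f (fst p))"
      by (rule bl_integrable[OF V_fin[OF \<mu>] bl_fst[OF A]])
    have iG: "integrable (V \<mu>) G" by (rule bl_integrable[OF V_fin[OF \<mu>] G(1)])
    have iC: "integrable (V \<mu>) (\<lambda>p. f (fst p) * c (fst p) \<mu>)"
      by (rule bl_integrable[OF V_fin[OF \<mu>] bl_fst[OF bfc]])
    have "(\<integral>x. f x \<partial>\<nu>) = (\<integral>p. ?A p \<partial>V \<mu>) + h * source f \<mu>"
      using st A unfolding is_step_def source_def by blast
    moreover have "(\<integral>x. f x \<partial>\<mu>) = (\<integral>p. f (fst p) \<partial>V \<mu>)"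
      using integral_V_fst[OF \<mu> bl_measurable[OF A]] by simp
    moreover have "growth f \<mu> = (\<integral>p. f (fst p) * c (fst p) \<mu> \<partial>V \<mu>)"
      unfolding growth_def using integral_V_fst[OF \<mu> bl_measurable[OF bfc]] by simp
    moreover have "drift f \<mu> = (\<integral>p. G p \<partial>V \<mu>)" using G(2)[OF \<mu> AE] by simp
    ultimately have eq: "(\<integral>x. f x \<partial>\<nu>) - (\<integral>x. f x \<partial>\<mu>) - h * (drift f \<mu> + growth f \<mu> + source f \<mu>)
      = (\<integral>p. ?A p - f (fst p) - h * G p - h * (f (fst p) * c (fst p) \<mu>) \<partial>V \<mu>)"
      using iA iF iG iC by (simp add: algebra_simps)
    have "\<bar>\<integral>p. ?A p - f (fst p) - h * G p - h * (f (fst p) * c (fst p) \<mu>) \<partial>V \<mu>\<bar>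
        \<le> ((C * W\<^sup>2 + Cb * (A * W)) * h\<^sup>2) * measure (V \<mu>) UNIV"
    proof (rule integral_abs_le_mass[OF V_fin[OF \<mu>]])
      show "AE p in V \<mu>. \<bar>?A p - f (fst p) - h * G p - h * (f (fst p) * c (fst p) \<mu>)\<bar>
          \<le> (C * W\<^sup>2 + Cb * (A * W)) * h\<^sup>2"
        using AE_V[OF \<mu> AE]
      proof eventually_elim
        fix p :: "'a \<times> 'a" assume p: "norm (fst p) \<le> R \<and> norm (snd p) \<le> CS * (1 + R)"
        let ?x = "fst p" and ?v = "snd p"
        have nv: "norm (h *\<^sub>R ?v) \<le> h * W" using p h by (simp add: W_def mult_left_mono)
        have lin: "linear (frechet_derivative f (at ?x))"
          by (rule has_derivative_linear[OF Cc_inf_derivative[OF f]])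
        have hG: "h * G p = frechet_derivative f (at ?x) (h *\<^sub>R ?v)"
          using G(3)[of p] p linear_scale[OF lin, of h ?v] by simp
        have "\<bar>f (?x + h *\<^sub>R ?v) - f ?x - h * G p\<bar> \<le> C * (norm (h *\<^sub>R ?v))\<^sup>2"
          unfolding hG by (rule C(2))
        also have "\<dots> \<le> C * (h * W)\<^sup>2" using nv C(1) by (intro mult_left_mono power_mono) auto
        finally have 1: "\<bar>f (?x + h *\<^sub>R ?v) - f ?x - h * G p\<bar> \<le> C * (h * W)\<^sup>2" .
        have "\<bar>f (?x + h *\<^sub>R ?v) - f ?x\<bar> \<le> A * norm (h *\<^sub>R ?v)"
          using bl_lip[OF A, of "?x + h *\<^sub>R ?v" ?x] by (simp add: dist_norm)
        also have "\<dots> \<le> A * (h * W)" using nv A0 by (intro mult_left_mono)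
        finally have "\<bar>h * c ?x \<mu> * (f (?x + h *\<^sub>R ?v) - f ?x)\<bar> \<le> (h * Cb) * (A * (h * W))"
          unfolding abs_mult using h C1[OF \<mu>] Cb by (intro mult_mono) auto
        moreover have "?A p - f ?x - h * G p - h * (f ?x * c ?x \<mu>)
            = (f (?x + h *\<^sub>R ?v) - f ?x - h * G p) + h * c ?x \<mu> * (f (?x + h *\<^sub>R ?v) - f ?x)"
          by (simp add: algebra_simps)
        ultimately have "\<bar>?A p - f ?x - h * G p - h * (f ?x * c ?x \<mu>)\<bar> \<le> C * (h * W)\<^sup>2 + (h * Cb) * (A * (h * W))"
          using 1 by linarith
        then show "\<bar>?A p - f ?x - h * G p - h * (f ?x * c ?x \<mu>)\<bar> \<le> (C * W\<^sup>2 + Cb * (A * W)) * h\<^sup>2"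
          by (simp add: power2_eq_square algebra_simps)
      qed
      show "0 \<le> (C * W\<^sup>2 + Cb * (A * W)) * h\<^sup>2" using C W Cb A0 by simp
    qed
    also have "\<dots> \<le> ((C * W\<^sup>2 + Cb * (A * W)) * h\<^sup>2) * m"
      unfolding mass_V[OF \<mu>] using C W Cb A0 mm by (intro mult_left_mono) auto
    finally show "\<bar>(\<integral>x. f x \<partial>\<nu>) - (\<integral>x. f x \<partial>\<mu>) - h * (drift f \<mu> + growth f \<mu> + source f \<mu>)\<bar>
        \<le> (C * W\<^sup>2 + Cb * (A * W)) * m * h\<^sup>2"
      unfolding eq by (simp add: mult_ac)
  qed
qed

end

section \<open>Growth of discrete products and summation of local errors\<close>

lemma one_plus_power_le_exp:
  fixes a h T :: real
  assumes "0 \<le> a" "0 \<le> h" "h * real k \<le> T"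
  shows "(1 + h * a) ^ k \<le> exp (a * T)"
proof -
  have "(1 + h * a) ^ k \<le> exp (h * a) ^ k"
    using assms by (intro power_mono exp_ge_add_one_self) auto
  also have "\<dots> = exp (a * (h * real k))" by (simp add: exp_of_nat_mult[symmetric] mult_ac)
  also have "\<dots> \<le> exp (a * T)" using assms by (simp add: mult_left_mono)
  finally show ?thesis .
qed

lemma has_real_derivative_of_quadratic_error:
  fixes \<phi> :: "real \<Rightarrow> real"
  assumes "\<And>t. t \<in> S \<Longrightarrow> \<bar>\<phi> t - \<phi> r - (t - r) * D\<bar> \<le> C * (t - r)\<^sup>2"
  shows "(\<phi> has_real_derivative D) (at r within S)"
  unfolding has_field_derivative_iff
proof (rule LIM_zero_cancel, rule Lim_null_comparison)
  show "\<forall>\<^sub>F t in at r within S. norm ((\<phi> t - \<phi> r) / (t - r) - D) \<le> C * \<bar>t - r\<bar>"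
    unfolding eventually_at_filter
  proof (rule always_eventually, intro allI impI)
    fix t assume t: "t \<noteq> r" "t \<in> S"
    have "(\<phi> t - \<phi> r) / (t - r) - D = (\<phi> t - \<phi> r - (t - r) * D) / (t - r)"
      using t by (simp add: field_simps)
    then have "norm ((\<phi> t - \<phi> r) / (t - r) - D) = \<bar>\<phi> t - \<phi> r - (t - r) * D\<bar> / \<bar>t - r\<bar>"
      by simp
    also have "\<dots> \<le> C * (t - r)\<^sup>2 / \<bar>t - r\<bar>"
      using assms[OF t(2)] by (intro divide_right_mono) auto
    also have "\<dots> = C * \<bar>t - r\<bar>"
    proof -
      have "(t - r)\<^sup>2 = \<bar>t - r\<bar> * \<bar>t - r\<bar>" by (simp add: power2_eq_square)
      moreover have "\<bar>t - r\<bar> \<noteq> 0" using t by simp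
      ultimately show ?thesis by (simp only: nonzero_mult_div_cancel_right mult.assoc[symmetric] not_False_eq_True)
    qed
    finally show "norm ((\<phi> t - \<phi> r) / (t - r) - D) \<le> C * \<bar>t - r\<bar>" .
  qed
  have "((\<lambda>t. C * \<bar>t - r\<bar>) \<longlongrightarrow> C * \<bar>r - r\<bar>) (at r within S)" by (intro tendsto_intros)
  then show "((\<lambda>t. C * \<bar>t - r\<bar>) \<longlongrightarrow> 0) (at r within S)" by simp
qed

lemma continuous_on_of_lipschitz:
  fixes g :: "real \<Rightarrow> real"
  assumes "0 \<le> C" "\<And>t r. t \<in> S \<Longrightarrow> r \<in> S \<Longrightarrow> \<bar>g t - g r\<bar> \<le> C * \<bar>t - r\<bar>"
  shows "continuous_on S g"
  by (rule lipschitz_on_continuous_on[of C]) (use assms in \<open>auto simp: lipschitz_on_def dist_real_def\<close>)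

lemma multistep_flat:
  assumes C: "\<And>k. k < n \<Longrightarrow> flat (e k) (e (Suc k)) \<le> C * h"
    and e: "\<And>k. fin_meas (e k)" and n: "j + d \<le> n"
  shows "flat (e j) (e (j + d)) \<le> C * (h * real d)"
  using n
proof (induction d)
  case 0 show ?case using flat_self by simp
next
  case (Suc d)
  have "flat (e j) (e (j + Suc d)) \<le> flat (e j) (e (j + d)) + flat (e (j + d)) (e (Suc (j + d)))"
    using flat_triangle[OF e e e] by simp
  also have "\<dots> \<le> C * (h * real d) + C * h" using Suc C[of "j + d"] by (intro add_mono) auto
  finally show ?case by (simp add: algebra_simps)
qed

text \<open>Freezing \<open>F\<close> at the first index, each of the \<open>d\<close> steps costs
  the local error \<open>C * h\<^sup>2\<close> and at most \<open>h * (C' * (h * real d))\<close>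
  for the variation of \<open>F\<close>.\<close>

lemma multistep_consistent:
  fixes \<phi> F :: "nat \<Rightarrow> real"
  assumes step: "\<And>k. k < n \<Longrightarrow> \<bar>\<phi> (Suc k) - \<phi> k - h * F k\<bar> \<le> C * h\<^sup>2"
    and F: "\<And>d. j + d \<le> n \<Longrightarrow> \<bar>F (j + d) - F j\<bar> \<le> C' * (h * real d)"
    and C': "0 \<le> C'" and h: "0 \<le> h" and n: "j + d \<le> n"
  shows "\<bar>\<phi> (j + d) - \<phi> j - h * real d * F j\<bar> \<le> h * real d * (C * h + C' * (h * real d))"
  using n
proof (induction d)
  case 0 show ?case by simp
next
  case (Suc d)
  have "\<bar>h * (F (j + d) - F j)\<bar> \<le> h * (C' * (h * real d))"
    unfolding abs_mult using F[of d] Suc h by (intro mult_mono) auto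
  moreover have "\<phi> (j + Suc d) - \<phi> j - h * real (Suc d) * F j
      = (\<phi> (j + d) - \<phi> j - h * real d * F j) + (\<phi> (Suc (j + d)) - \<phi> (j + d) - h * F (j + d))
        + h * (F (j + d) - F j)"
    by (simp add: algebra_simps)
  ultimately have "\<bar>\<phi> (j + Suc d) - \<phi> j - h * real (Suc d) * F j\<bar>
      \<le> h * real d * (C * h + C' * (h * real d)) + C * h\<^sup>2 + h * (C' * (h * real d))"
    using Suc step[of "j + d"] by simp
  also have "\<dots> \<le> h * real (Suc d) * (C * h + C' * (h * real (Suc d)))"
  proof -
    have "0 \<le> C' * h\<^sup>2 * (real d + 1)" using C' by simp
    moreover have "h * real (Suc d) * (C * h + C' * (h * real (Suc d)))
        = (h * real d * (C * h + C' * (h * real d)) + C * h\<^sup>2 + h * (C' * (h * real d))) + C' * h\<^sup>2 * (real d + 1)"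
      by (simp add: algebra_simps power2_eq_square)
    ultimately show ?thesis by linarith
  qed
  finally show ?case .
qed

section \<open>A priori bounds for the Euler iterates\<close>

context mde
begin

text \<open>Solves the recursion of radii in \<open>step_exists\<close>: each step multiplies
  \<open>1 + rad\<close> by \<open>1 + h * CS\<close>, starting from \<open>1 + R\<close>.\<close>

definition rad :: "real \<Rightarrow> real \<Rightarrow> nat \<Rightarrow> real" where
  "rad R h k = (1 + R) * (1 + h * CS) ^ k - 1"

text \<open>The radius bound is part of the choice because \<open>is_step\<close> does not mention
  supports and the next step needs it.\<close>

primrec euler :: "real \<Rightarrow> real \<Rightarrow> nat \<Rightarrow> 'a measure" where
  "euler R h 0 = \<mu>0"
| "euler R h (Suc k) =
    (SOME \<nu>. is_step h (euler R h k) \<nu> \<and> (AE x in \<nu>. norm x \<le> rad R h (Suc k)))"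

context
  fixes R h :: real
  assumes R: "Rs \<le> R" "0 \<le> R" "AE x in \<mu>0. norm x \<le> R" and h: "0 \<le> h" "h * Cb \<le> 1"
begin

lemma rad_ge: "R \<le> rad R h k"
proof -
  have "(1 + R) * 1 \<le> (1 + R) * (1 + h * CS) ^ k"
    using R h CS by (intro mult_left_mono one_le_power) auto
  then show ?thesis by (simp add: rad_def)
qed

lemma euler_step_aux:
  assumes "fin_meas (euler R h k)" "AE x in euler R h k. norm x \<le> rad R h k"
  shows "is_step h (euler R h k) (euler R h (Suc k)) \<and>
    (AE x in euler R h (Suc k). norm x \<le> rad R h (Suc k))"
proof -
  have "rad R h (Suc k) = rad R h k + h * (CS * (1 + rad R h k))"
    by (simp add: rad_def algebra_simps)
  then have "\<exists>\<nu>. is_step h (euler R h k) \<nu> \<and> (AE x in \<nu>. norm x \<le> rad R h (Suc k))"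
    using step_exists[OF assms _ _ h] rad_ge[of k] R by simp
  from someI_ex[OF this] show ?thesis unfolding euler.simps .
qed

lemma euler_invariant: "fin_meas (euler R h k)" "AE x in euler R h k. norm x \<le> rad R h k"
proof (induction k)
  case 0
  { case 1 show ?case using mu0 by simp
  next
    case 2 show ?case using R(3) unfolding euler.simps rad_def by simp }
next
  case (Suc k)
  { case 1 show ?case using euler_step_aux[OF Suc] by (simp add: is_step_def)
  next
    case 2 show ?case using euler_step_aux[OF Suc] by simp }
qed

lemma euler_is_step: "is_step h (euler R h k) (euler R h (Suc k))"
  using euler_step_aux[OF euler_invariant] by simp

text \<open>Adding 1 to the mass absorbs the constant part of the source and turns the affine
  recursion into a multiplicative one.\<close>

lemma euler_mass:
  "measure (euler R h k) UNIV + 1 \<le> (measure \<mu>0 UNIV + 1) *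
    (1 + h * (Cb + L + measure (s \<mu>0) UNIV + L * measure \<mu>0 UNIV)) ^ k"
proof (induction k)
  case 0 show ?case by simp
next
  case (Suc k)
  define S where "S = measure (s \<mu>0) UNIV"
  define m0 where "m0 = measure \<mu>0 UNIV"
  define m where "m = measure (euler R h k) UNIV"
  define B where "B = Cb + L + S + L * m0"
  have nn: "0 \<le> S" "0 \<le> m0" "0 \<le> m" by (auto simp: S_def m0_def m_def)
  have "measure (euler R h (Suc k)) UNIV \<le> m + h * (Cb * m + measure (s (euler R h k)) UNIV)"
    unfolding m_def by (rule mass_step[OF euler_invariant(1) euler_is_step h(1)])
  also have "\<dots> \<le> m + h * (Cb * m + (S + L * (m + m0)))"
    using mass_s[OF euler_invariant(1)[of k]] h
    by (intro add_left_mono mult_left_mono) (auto simp: S_def m_def m0_def)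
  also have "\<dots> \<le> m + h * (B * (m + 1))"
  proof (intro add_left_mono mult_left_mono h)
    have "0 \<le> Cb + L" "0 \<le> S * m" "0 \<le> L * m0 * m" using nn Cb L by auto
    moreover have "B * (m + 1) = Cb * m + (S + L * (m + m0)) + (Cb + L + S * m + L * m0 * m)"
      by (simp add: B_def algebra_simps)
    ultimately show "Cb * m + (S + L * (m + m0)) \<le> B * (m + 1)" by linarith
  qed
  finally have "measure (euler R h (Suc k)) UNIV + 1 \<le> (m + 1) * (1 + h * B)" by (simp add: algebra_simps)
  also have "\<dots> \<le> ((m0 + 1) * (1 + h * B) ^ k) * (1 + h * B)"
    using Suc h nn Cb L by (intro mult_right_mono) (auto simp: m_def m0_def B_def S_def)
  finally show ?case by (simp add: B_def S_def m0_def mult_ac)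
qed

end

text \<open>Discrete Gronwall: the powers from \<open>rad\<close> and \<open>euler_mass\<close> are
  bounded by exponentials in \<open>T\<close>, so radius and mass bounds do not depend on the step
  size.\<close>

lemma euler_admissible:
  assumes R: "Rs \<le> R" "0 \<le> R" "AE x in \<mu>0. norm x \<le> R" and T: "0 \<le> T"
  obtains R1 m where "0 < R1" "0 \<le> m"
    "\<And>h k. 0 \<le> h \<Longrightarrow> h * Cb \<le> 1 \<Longrightarrow> h * real k \<le> T \<Longrightarrow> admissible R1 m (euler R h k)"
proof -
  define B where "B = Cb + L + measure (s \<mu>0) UNIV + L * measure \<mu>0 UNIV"
  have B: "0 \<le> B" using Cb L by (simp add: B_def)
  show ?thesis
  proof (rule that[of "(1 + R) * exp (CS * T)" "(measure \<mu>0 UNIV + 1) * exp (B * T)"])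
    show "0 < (1 + R) * exp (CS * T)" using R by simp
    show "0 \<le> (measure \<mu>0 UNIV + 1) * exp (B * T)" by simp
    fix h :: real and k :: nat assume h: "0 \<le> h" "h * Cb \<le> 1" and k: "h * real k \<le> T"
    have "rad R h k \<le> (1 + R) * (1 + h * CS) ^ k" by (simp add: rad_def)
    also have "\<dots> \<le> (1 + R) * exp (CS * T)"
      using one_plus_power_le_exp[of CS h k T] CS h k R by (intro mult_left_mono) auto
    finally have rad: "rad R h k \<le> (1 + R) * exp (CS * T)" .
    have "measure (euler R h k) UNIV \<le> (measure \<mu>0 UNIV + 1) * (1 + h * B) ^ k"
      using euler_mass[OF R h, of k] by (simp add: B_def)
    also have "\<dots> \<le> (measure \<mu>0 UNIV + 1) * exp (B * T)"
      by (intro mult_left_mono one_plus_power_le_exp B h k) simp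
    finally show "admissible ((1 + R) * exp (CS * T)) ((measure \<mu>0 UNIV + 1) * exp (B * T)) (euler R h k)"
      unfolding admissible_def
      using euler_invariant(1)[OF R h, of k] AE_mp[OF euler_invariant(2)[OF R h, of k] AE_I2] rad by auto
  qed
qed

end

subsection \<open>Passage to the limit\<close>

context mde
begin

theorem solution_exists:
  assumes mu0_supp: "compact (supp \<mu>0)" and T: "0 < T"
  shows "\<exists>\<mu> :: real \<Rightarrow> 'a measure.
     (\<forall>t\<in>{0..T}. fin_meas (\<mu> t)) \<and> \<mu> 0 = \<mu>0 \<and>
     (\<forall>f. Cc_inf f \<longrightarrow>
        (\<forall>r\<in>{0..T}. integrable (V (\<mu> r)) (\<lambda>(x,v). frechet_derivative f (at x) v)) \<and>
        (\<forall>t\<in>{0..T}.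
          (\<lambda>r. drift f (\<mu> r)) integrable_on {0..t} \<and>
          (\<lambda>r. growth f (\<mu> r)) integrable_on {0..t} \<and>
          (\<lambda>r. source f (\<mu> r)) integrable_on {0..t} \<and>
          (\<integral>x. f x \<partial>\<mu> t) - (\<integral>x. f x \<partial>\<mu>0) =
            integral {0..t} (\<lambda>r. drift f (\<mu> r))
          + integral {0..t} (\<lambda>r. growth f (\<mu> r))
          + integral {0..t} (\<lambda>r. source f (\<mu> r)))) \<and>
     (\<exists>K\<ge>0. \<forall>t\<in>{0..T}. \<forall>r\<in>{0..T}. flat (\<mu> t) (\<mu> r) \<le> K * \<bar>t - r\<bar>)"
proof -
  obtain R0 where R0: "\<And>x. x \<in> supp \<mu>0 \<Longrightarrow> norm x \<le> R0"
    using compact_imp_bounded[OF mu0_supp] unfolding bounded_iff by blast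
  \<comment> \<open>The ball has to contain the support of every source as well as that of the
    initial measure.\<close>
  define R where "R = max (max Rs 0) R0"
  have "supp \<mu>0 \<subseteq> cball 0 R" using R0 by (force simp: R_def)
  then have R: "Rs \<le> R" "0 \<le> R" "AE x in \<mu>0. norm x \<le> R"
    using supp_subset_iff[OF mu0, of "cball 0 R"] by (auto simp: R_def)
  obtain R1 m where R1: "0 < R1" and m: "0 \<le> m" and adm_euler:
    "\<And>h k. 0 \<le> h \<Longrightarrow> h * Cb \<le> 1 \<Longrightarrow> h * real k \<le> T \<Longrightarrow> admissible R1 m (euler R h k)"
    by (rule euler_admissible[OF R less_imp_le[OF T]]) blast
  obtain C1 where C1: "0 \<le> C1"
    "\<And>h \<mu> \<nu>. 0 \<le> h \<Longrightarrow> admissible R1 m \<mu> \<Longrightarrow> is_step h \<mu> \<nu> \<Longrightarrow> flat \<mu> \<nu> \<le> C1 * h"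
    by (rule flat_step[OF less_imp_le[OF R1] m]) blast
  \<comment> \<open>Shifting the index by \<open>n0\<close> gives \<open>h n * Cb \<le> 1\<close>
    for every \<open>n\<close>, not only for large \<open>n\<close>.\<close>
  obtain n0 where n0: "T * Cb < real n0" using reals_Archimedean2 by blast
  have n0pos: "0 < real n0" using n0 T Cb mult_pos_pos[of T Cb] by linarith
  define h where "h n = T / real (n + n0)" for n
  have h_pos: "0 < h n" for n using T n0pos by (simp add: h_def)
  have h_Cb: "h n * Cb \<le> 1" for n
    using n0 n0pos T by (simp add: h_def divide_le_eq)
  have h_lim: "h \<longlonglongrightarrow> 0"
    unfolding h_def by (rule LIMSEQ_ignore_initial_segment[OF lim_const_over_n])
  \<comment> \<open>Times are rounded down to the grid, so the approximating curves are piecewise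
    constant.\<close>
  define idx where "idx n t = nat \<lfloor>t / h n\<rfloor>" for n t
  have idx: "h n * real (idx n t) \<le> t" "t < h n * real (idx n t) + h n" if "0 \<le> t" for n t
  proof -
    have "real (idx n t) \<le> t / h n" "t / h n < real (idx n t) + 1"
      unfolding idx_def using that h_pos[of n] by (auto simp: of_nat_floor)
    then show "h n * real (idx n t) \<le> t" "t < h n * real (idx n t) + h n"
      using h_pos[of n] by (simp_all add: field_simps)
  qed
  define N where "N n t = euler R (h n) (idx n t)" for n t
  have admN: "admissible R1 m (N n t)" if "t \<in> {0..T}" for n t
    unfolding N_def using that idx(1)[of t n] h_pos[of n] h_Cb[of n] by (intro adm_euler) auto
  \<comment> \<open>Both rounding errors lie in \<open>[0, h n)\<close>, so their difference is at
    most \<open>h n\<close> in absolute value.\<close>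
  have steps: "\<exists>d. idx n t = idx n r + d \<and> \<bar>h n * real d - (t - r)\<bar> \<le> h n"
    if "0 \<le> r" "r \<le> t" for n r t
  proof -
    have "idx n r \<le> idx n t"
      unfolding idx_def using that h_pos[of n] by (intro nat_mono floor_mono divide_right_mono) auto
    then obtain d where d: "idx n t = idx n r + d" using le_Suc_ex by blast
    have "h n * real (idx n t) = h n * real (idx n r) + h n * real d" by (simp add: d algebra_simps)
    then have "\<bar>h n * real d - (t - r)\<bar> \<le> h n"
      using idx[of r n] idx[of t n] that by linarith
    then show ?thesis using d by blast
  qed
  have adm_le: "admissible R1 m (euler R (h n) k)" if "k \<le> idx n t" "t \<in> {0..T}" for n k t
  proof (rule adm_euler[OF less_imp_le[OF h_pos] h_Cb])
    have "h n * real k \<le> h n * real (idx n t)" using that h_pos[of n] by (intro mult_left_mono) auto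
    then show "h n * real k \<le> T" using idx(1)[of t n] that by auto
  qed
  have fin_euler: "fin_meas (euler R (h n) k)" for n k
    by (rule euler_invariant(1)[OF R less_imp_le[OF h_pos] h_Cb])
  have is_step_euler: "is_step (h n) (euler R (h n) k) (euler R (h n) (Suc k))" for n k
    by (rule euler_is_step[OF R less_imp_le[OF h_pos] h_Cb])
  have flat_euler: "flat (euler R (h n) j) (euler R (h n) (j + d)) \<le> C1 * (h n * real d)"
    if "j + d \<le> idx n t" "t \<in> {0..T}" for n j d t
  proof (rule multistep_flat[where n = "idx n t"])
    fix k assume "k < idx n t"
    then show "flat (euler R (h n) k) (euler R (h n) (Suc k)) \<le> C1 * h n"
      using that(2) by (intro C1(2)[OF less_imp_le[OF h_pos] adm_le is_step_euler]) auto
  qed (use that fin_euler in auto)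
  have lip1: "flat (N n r) (N n t) \<le> C1 * (\<bar>t - r\<bar> + h n)" if r: "r \<in> {0..T}" and "t \<in> {0..T}" and rt: "r \<le> t" for n r t
  proof -
    obtain d where d: "idx n t = idx n r + d" "\<bar>h n * real d - (t - r)\<bar> \<le> h n"
      using steps[OF _ rt, of n] r by auto
    have "flat (N n r) (N n t) \<le> C1 * (h n * real d)"
      unfolding N_def d(1) using that d(1) by (intro flat_euler[where t = t]) auto
    also have "\<dots> \<le> C1 * (\<bar>t - r\<bar> + h n)" using d(2) C1(1) by (intro mult_left_mono) linarith
    finally show ?thesis .
  qed
  have finN: "fin_meas (N n t)" for n t unfolding N_def by (rule fin_euler)
  have lip: "flat (N n t) (N n r) \<le> C1 * (\<bar>t - r\<bar> + h n)" if "t \<in> {0..T}" "r \<in> {0..T}" for n r t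
    using lip1[OF that, of n] lip1[OF that(2,1), of n] flat_sym[OF finN finN, of n t n r]
    by (cases "t \<le> r") (auto simp: abs_minus_commute)
  have N0: "N n 0 = \<mu>0" for n by (simp add: N_def idx_def)
  have AEN: "AE x in N n t. x \<in> cball 0 R1" and massN: "measure (N n t) UNIV \<le> m" if "t \<in> {0..T}" for n t
    using admN[OF that, of n] by (auto simp: admissible_def)
  obtain k \<mu> where k: "strict_mono (k :: nat \<Rightarrow> nat)" and \<mu>0: "\<mu> 0 = \<mu>0"
    and fin: "\<And>t. t \<in> {0..T} \<Longrightarrow> fin_meas (\<mu> t)" and AE\<mu>: "\<And>t. t \<in> {0..T} \<Longrightarrow> AE x in \<mu> t. x \<in> cball 0 R1"
    and mass\<mu>: "\<And>t. t \<in> {0..T} \<Longrightarrow> measure (\<mu> t) UNIV \<le> m"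
    and lim: "\<And>t. t \<in> {0..T} \<Longrightarrow> (\<lambda>n. flat (N (k n) t) (\<mu> t)) \<longlonglongrightarrow> 0"
    by (rule flat_curves_convergent_subsequence[of "cball 0 R1" T N m C1 h \<mu>0,
          OF compact_cball less_imp_le[OF T] finN AEN massN lip h_lim N0])
       (assumption+, rule that, assumption, assumption, blast+)
  have adm: "admissible R1 m (\<mu> t)" if "t \<in> {0..T}" for t
    using fin[OF that] AE\<mu>[OF that] mass\<mu>[OF that] by (simp add: admissible_def)
  have hk: "(\<lambda>n. h (k n)) \<longlonglongrightarrow> 0"
    using LIMSEQ_subseq_LIMSEQ[OF h_lim k] by (simp add: o_def)
  \<comment> \<open>The rounding error \<open>h (k n)\<close> vanishes in the limit, so the jumps of
    the approximations disappear and the constant \<open>C1\<close> survives.\<close>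
  have \<mu>_lip: "flat (\<mu> t) (\<mu> r) \<le> C1 * \<bar>t - r\<bar>" if t: "t \<in> {0..T}" and r: "r \<in> {0..T}" for t r
  proof (rule LIMSEQ_le_const)
    have "(\<lambda>n. flat (N (k n) t) (\<mu> t) + C1 * (\<bar>t - r\<bar> + h (k n)) + flat (N (k n) r) (\<mu> r))
        \<longlonglongrightarrow> 0 + C1 * (\<bar>t - r\<bar> + 0) + 0"
      by (intro tendsto_intros lim t r hk)
    then show "(\<lambda>n. flat (N (k n) t) (\<mu> t) + C1 * (\<bar>t - r\<bar> + h (k n)) + flat (N (k n) r) (\<mu> r))
        \<longlonglongrightarrow> C1 * \<bar>t - r\<bar>" by simp
    have "flat (\<mu> t) (\<mu> r) \<le> flat (N (k n) t) (\<mu> t) + C1 * (\<bar>t - r\<bar> + h (k n)) + flat (N (k n) r) (\<mu> r)" for n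
      using flat_triangle[OF fin[OF t] finN fin[OF r], of "k n" t]
        flat_triangle[OF finN finN fin[OF r], of "k n" t "k n" r] lip[OF t r, of "k n"]
        flat_sym[OF fin[OF t] finN, of "k n" t] by linarith
    then show "\<exists>n1. \<forall>n\<ge>n1. flat (\<mu> t) (\<mu> r) \<le>
        flat (N (k n) t) (\<mu> t) + C1 * (\<bar>t - r\<bar> + h (k n)) + flat (N (k n) r) (\<mu> r)" by blast
  qed
  have weak: "(\<forall>r\<in>{0..T}. integrable (V (\<mu> r)) (\<lambda>(x,v). frechet_derivative f (at x) v)) \<and>
        (\<forall>t\<in>{0..T}.
          (\<lambda>r. drift f (\<mu> r)) integrable_on {0..t} \<and>
          (\<lambda>r. growth f (\<mu> r)) integrable_on {0..t} \<and>
          (\<lambda>r. source f (\<mu> r)) integrable_on {0..t} \<and>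
          (\<integral>x. f x \<partial>\<mu> t) - (\<integral>x. f x \<partial>\<mu>0) =
            integral {0..t} (\<lambda>r. drift f (\<mu> r))
          + integral {0..t} (\<lambda>r. growth f (\<mu> r))
          + integral {0..t} (\<lambda>r. source f (\<mu> r)))" if f: "Cc_inf f" for f
  proof -
    obtain A where A: "bl A f" by (rule Cc_inf_bl[OF f]) blast
    have A0: "0 \<le> A" using bl_nonneg[OF A] .
    obtain D1 where D1: "0 \<le> D1" "\<And>\<mu> \<nu>. admissible R1 m \<mu> \<Longrightarrow> admissible R1 m \<nu> \<Longrightarrow>
        \<bar>drift f \<mu> - drift f \<nu>\<bar> \<le> D1 * flat \<mu> \<nu>"
      by (rule drift_lipschitz[OF f R1, of m]) blast
    obtain D2 where D2: "0 \<le> D2" "\<And>\<mu> \<nu>. admissible R1 m \<mu> \<Longrightarrow> admissible R1 m \<nu> \<Longrightarrow>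
        \<bar>growth f \<mu> - growth f \<nu>\<bar> \<le> D2 * flat \<mu> \<nu>"
      by (rule growth_lipschitz[OF A m, of R1]) blast
    have D3: "0 \<le> A * L" "\<And>\<mu> \<nu>. admissible R1 m \<mu> \<Longrightarrow> admissible R1 m \<nu> \<Longrightarrow>
        \<bar>source f \<mu> - source f \<nu>\<bar> \<le> A * L * flat \<mu> \<nu>"
      using source_lipschitz[OF A] A0 L by (auto simp: admissible_def)
    obtain C2 where C2: "0 \<le> C2" "\<And>h \<mu> \<nu>. 0 \<le> h \<Longrightarrow> admissible R1 m \<mu> \<Longrightarrow> is_step h \<mu> \<nu> \<Longrightarrow>
        \<bar>(\<integral>x. f x \<partial>\<nu>) - (\<integral>x. f x \<partial>\<mu>) - h * (drift f \<mu> + growth f \<mu> + source f \<mu>)\<bar> \<le> C2 * h\<^sup>2"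
      by (rule step_consistent[OF f less_imp_le[OF R1] m]) blast
    define F where "F \<nu> = drift f \<nu> + growth f \<nu> + source f \<nu>" for \<nu>
    define D where "D = D1 + D2 + A * L"
    have D: "0 \<le> D" using D1(1) D2(1) D3(1) by (simp add: D_def)
    have F_lip: "\<bar>F \<mu> - F \<nu>\<bar> \<le> D * flat \<mu> \<nu>" if "admissible R1 m \<mu>" "admissible R1 m \<nu>" for \<mu> \<nu>
      using D1(2)[OF that] D2(2)[OF that] D3(2)[OF that] unfolding F_def D_def distrib_right by linarith
    let ?E = "D * C1"
    have E: "0 \<le> ?E" using D C1(1) by simp
    \<comment> \<open>The grid time \<open>h n * real d\<close> replaces \<open>t - r\<close> up to
      \<open>h n\<close>; this accounts for the enlarged length in the quadratic part and for the
      extra term \<open>h n * \<bar>F (N n r)\<bar>\<close>.\<close>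
    have disc: "\<bar>(\<integral>x. f x \<partial>N n t) - (\<integral>x. f x \<partial>N n r) - (t - r) * F (N n r)\<bar>
        \<le> (t - r + h n) * (C2 * h n + ?E * (t - r + h n)) + h n * \<bar>F (N n r)\<bar>"
      if r: "r \<in> {0..T}" and t: "t \<in> {0..T}" and rt: "r \<le> t" for n r t
    proof -
      obtain d where d: "idx n t = idx n r + d" "\<bar>h n * real d - (t - r)\<bar> \<le> h n"
        using steps[OF _ rt, of n] r by auto
      let ?e = "euler R (h n)" and ?j = "idx n r"
      have 1: "\<bar>(\<integral>x. f x \<partial>?e (?j + d)) - (\<integral>x. f x \<partial>?e ?j) - h n * real d * F (?e ?j)\<bar>
          \<le> h n * real d * (C2 * h n + ?E * (h n * real d))"
      proof (rule multistep_consistent[where n = "idx n t" and F = "\<lambda>j. F (?e j)" and \<phi> = "\<lambda>j. \<integral>x. f x \<partial>?e j"])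
        fix k assume "k < idx n t"
        then have "admissible R1 m (?e k)" using t by (intro adm_le) auto
        from C2(2)[OF less_imp_le[OF h_pos] this is_step_euler]
        show "\<bar>(\<integral>x. f x \<partial>?e (Suc k)) - (\<integral>x. f x \<partial>?e k) - h n * F (?e k)\<bar> \<le> C2 * (h n)\<^sup>2"
          unfolding F_def .
      next
        fix d assume d: "?j + d \<le> idx n t"
        have "\<bar>F (?e (?j + d)) - F (?e ?j)\<bar> = \<bar>F (?e ?j) - F (?e (?j + d))\<bar>" by simp
        also have "\<dots> \<le> D * flat (?e ?j) (?e (?j + d))"
          using d t by (intro F_lip adm_le[where t = t]) auto
        also have "\<dots> \<le> D * (C1 * (h n * real d))" using flat_euler[OF d t] D by (intro mult_left_mono)
        finally show "\<bar>F (?e (?j + d)) - F (?e ?j)\<bar> \<le> ?E * (h n * real d)" by (simp add: mult_ac)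
      qed (use E h_pos[of n] d in auto)
      have hd: "h n * real d \<le> t - r + h n" "0 \<le> h n * real d" using d(2) h_pos[of n] by auto
      have "h n * real d * (C2 * h n + ?E * (h n * real d)) \<le> (t - r + h n) * (C2 * h n + ?E * (t - r + h n))"
        using hd E C2(1) h_pos[of n] \<open>r \<le> t\<close>
        by (intro mult_mono add_left_mono mult_left_mono) auto
      moreover have "\<bar>(h n * real d - (t - r)) * F (?e ?j)\<bar> \<le> h n * \<bar>F (?e ?j)\<bar>"
        unfolding abs_mult using d(2) by (intro mult_right_mono) auto
      moreover have "(\<integral>x. f x \<partial>N n t) - (\<integral>x. f x \<partial>N n r) - (t - r) * F (N n r)
          = ((\<integral>x. f x \<partial>?e (?j + d)) - (\<integral>x. f x \<partial>?e ?j) - h n * real d * F (?e ?j)) + (h n * real d - (t - r)) * F (?e ?j)"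
        unfolding N_def d(1) by (simp add: algebra_simps)
      ultimately show ?thesis using 1 unfolding N_def by linarith
    qed
    have fN: "(\<lambda>n. \<integral>x. f x \<partial>N (k n) t) \<longlonglongrightarrow> (\<integral>x. f x \<partial>\<mu> t)" if t: "t \<in> {0..T}" for t
    proof (rule LIM_zero_cancel, rule Lim_null_comparison)
      show "\<forall>\<^sub>F n in sequentially. norm ((\<integral>x. f x \<partial>N (k n) t) - (\<integral>x. f x \<partial>\<mu> t)) \<le> A * flat (N (k n) t) (\<mu> t)"
        using bl_integral_diff_le[OF finN fin[OF t] A] by simp
      show "(\<lambda>n. A * flat (N (k n) t) (\<mu> t)) \<longlonglongrightarrow> 0"
        using tendsto_mult_left[OF lim[OF t], of A] by simp
    qed
    have FN: "(\<lambda>n. F (N (k n) t)) \<longlonglongrightarrow> F (\<mu> t)" if t: "t \<in> {0..T}" for t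
    proof (rule LIM_zero_cancel, rule Lim_null_comparison)
      show "\<forall>\<^sub>F n in sequentially. norm (F (N (k n) t) - F (\<mu> t)) \<le> D * flat (N (k n) t) (\<mu> t)"
        using F_lip[OF admN[OF t] adm[OF t]] by simp
      show "(\<lambda>n. D * flat (N (k n) t) (\<mu> t)) \<longlonglongrightarrow> 0"
        using tendsto_mult_left[OF lim[OF t], of D] by simp
    qed
    define \<phi> where "\<phi> t = (\<integral>x. f x \<partial>\<mu> t)" for t
    have quad1: "\<bar>\<phi> t - \<phi> r - (t - r) * F (\<mu> r)\<bar> \<le> ?E * (t - r)\<^sup>2"
      if r: "r \<in> {0..T}" and t: "t \<in> {0..T}" and rt: "r \<le> t" for r t
    proof (rule LIMSEQ_le)
      show "(\<lambda>n. \<bar>(\<integral>x. f x \<partial>N (k n) t) - (\<integral>x. f x \<partial>N (k n) r) - (t - r) * F (N (k n) r)\<bar>)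
          \<longlonglongrightarrow> \<bar>\<phi> t - \<phi> r - (t - r) * F (\<mu> r)\<bar>"
        unfolding \<phi>_def by (intro tendsto_intros fN FN r t)
      have "(\<lambda>n. (t - r + h (k n)) * (C2 * h (k n) + ?E * (t - r + h (k n))) + h (k n) * \<bar>F (N (k n) r)\<bar>)
          \<longlonglongrightarrow> (t - r + 0) * (C2 * 0 + ?E * (t - r + 0)) + 0 * \<bar>F (\<mu> r)\<bar>"
        by (intro tendsto_intros hk FN r)
      then show "(\<lambda>n. (t - r + h (k n)) * (C2 * h (k n) + ?E * (t - r + h (k n))) + h (k n) * \<bar>F (N (k n) r)\<bar>)
          \<longlonglongrightarrow> ?E * (t - r)\<^sup>2" by (simp add: power2_eq_square mult_ac)
      show "\<exists>n1. \<forall>n\<ge>n1. \<bar>(\<integral>x. f x \<partial>N (k n) t) - (\<integral>x. f x \<partial>N (k n) r) - (t - r) * F (N (k n) r)\<bar>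
          \<le> (t - r + h (k n)) * (C2 * h (k n) + ?E * (t - r + h (k n))) + h (k n) * \<bar>F (N (k n) r)\<bar>"
        using disc[OF r t rt] by blast
    qed
    have F\<mu>_lip: "\<bar>F (\<mu> t) - F (\<mu> r)\<bar> \<le> ?E * \<bar>t - r\<bar>" if "t \<in> {0..T}" "r \<in> {0..T}" for t r
      using order_trans[OF F_lip[OF adm[OF that(1)] adm[OF that(2)]] mult_left_mono[OF \<mu>_lip[OF that] D]]
      by (simp add: mult.assoc)
    \<comment> \<open>The scheme only gives estimates forward in time. For \<open>t < r\<close> the
      roles are exchanged, and replacing the base value \<open>F (\<mu> t)\<close> by
      \<open>F (\<mu> r)\<close> costs a second \<open>?E * (t - r)\<^sup>2\<close>; thus the factor
      2.\<close>
    have quad: "\<bar>\<phi> t - \<phi> r - (t - r) * F (\<mu> r)\<bar> \<le> (2 * ?E) * (t - r)\<^sup>2"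
      if r: "r \<in> {0..T}" and t: "t \<in> {0..T}" for r t
    proof (cases "r \<le> t")
      case True
      have "0 \<le> ?E * (t - r)\<^sup>2" using E by simp
      then show ?thesis using quad1[OF r t True] by linarith
    next
      case False
      have "\<bar>(t - r) * (F (\<mu> t) - F (\<mu> r))\<bar> \<le> \<bar>t - r\<bar> * (?E * \<bar>t - r\<bar>)"
        unfolding abs_mult using F\<mu>_lip[OF t r] by (intro mult_left_mono) auto
      also have "\<dots> = ?E * (\<bar>t - r\<bar> * \<bar>t - r\<bar>)" by (simp only: mult_ac)
      also have "\<dots> = ?E * (t - r)\<^sup>2" by (simp only: abs_mult_self_eq power2_eq_square)
      finally have 2: "\<bar>(t - r) * (F (\<mu> t) - F (\<mu> r))\<bar> \<le> ?E * (t - r)\<^sup>2" .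
      have "\<bar>\<phi> r - \<phi> t - (r - t) * F (\<mu> t)\<bar> \<le> ?E * (t - r)\<^sup>2"
        using quad1[OF t r] False by (simp add: power2_commute[of r t])
      moreover have "\<phi> t - \<phi> r - (t - r) * F (\<mu> r) = - (\<phi> r - \<phi> t - (r - t) * F (\<mu> t)) + (t - r) * (F (\<mu> t) - F (\<mu> r))"
        by (simp add: algebra_simps)
      ultimately show ?thesis using 2 by linarith
    qed
    \<comment> \<open>Any flat-Lipschitz functional is Lipschitz in time along the curve, so the
      three terms are integrable separately and not only in sum.\<close>
    have integ: "(\<lambda>r. G (\<mu> r)) integrable_on {0..t}"
      if t: "t \<in> {0..T}" and B: "0 \<le> B"
        and G: "\<And>\<mu> \<nu>. admissible R1 m \<mu> \<Longrightarrow> admissible R1 m \<nu> \<Longrightarrow> \<bar>G \<mu> - G \<nu>\<bar> \<le> B * flat \<mu> \<nu>"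
      for G :: "'a measure \<Rightarrow> real" and B t
    proof (rule integrable_continuous_interval, rule continuous_on_of_lipschitz[of "B * C1"])
      fix x y assume "x \<in> {0..t}" "y \<in> {0..t}"
      then have xy: "x \<in> {0..T}" "y \<in> {0..T}" using t by auto
      show "\<bar>G (\<mu> x) - G (\<mu> y)\<bar> \<le> B * C1 * \<bar>x - y\<bar>"
        using order_trans[OF G[OF adm[OF xy(1)] adm[OF xy(2)]] mult_left_mono[OF \<mu>_lip[OF xy] B]]
        by (simp add: mult.assoc)
    qed (use B C1 in simp)
    show ?thesis
    proof (intro conjI ballI)
      fix r assume "r \<in> {0..T}"
      then have r: "fin_meas (\<mu> r)" "AE x in \<mu> r. norm x \<le> R1" using adm by (auto simp: admissible_def)
      show "integrable (V (\<mu> r)) (\<lambda>(x,v). frechet_derivative f (at x) v)"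
        by (rule drift_eq[OF f less_imp_le[OF R1]]) (use r in blast)
    next
      fix t assume t: "t \<in> {0..T}"
      show i1: "(\<lambda>r. drift f (\<mu> r)) integrable_on {0..t}" by (rule integ[OF t D1])
      show i2: "(\<lambda>r. growth f (\<mu> r)) integrable_on {0..t}" by (rule integ[OF t D2])
      show i3: "(\<lambda>r. source f (\<mu> r)) integrable_on {0..t}" by (rule integ[OF t D3])
      have "((\<lambda>r. F (\<mu> r)) has_integral \<phi> t - \<phi> 0) {0..t}"
      proof (rule fundamental_theorem_of_calculus)
        show "0 \<le> t" using t by simp
        fix r assume "r \<in> {0..t}"
        then have "(\<phi> has_real_derivative F (\<mu> r)) (at r within {0..t})"
          using t by (intro has_real_derivative_of_quadratic_error[of _ _ _ _ "2 * ?E"] quad) auto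
        then show "(\<phi> has_vector_derivative F (\<mu> r)) (at r within {0..t})"
          by (simp add: has_real_derivative_iff_has_vector_derivative)
      qed
      moreover have "((\<lambda>r. F (\<mu> r)) has_integral
          (integral {0..t} (\<lambda>r. drift f (\<mu> r)) + integral {0..t} (\<lambda>r. growth f (\<mu> r))
            + integral {0..t} (\<lambda>r. source f (\<mu> r)))) {0..t}"
        unfolding F_def by (intro has_integral_add integrable_integral i1 i2 i3)
      ultimately show "(\<integral>x. f x \<partial>\<mu> t) - (\<integral>x. f x \<partial>\<mu>0) =
          integral {0..t} (\<lambda>r. drift f (\<mu> r)) + integral {0..t} (\<lambda>r. growth f (\<mu> r))
          + integral {0..t} (\<lambda>r. source f (\<mu> r))"
        unfolding \<phi>_def \<mu>0 by (rule has_integral_unique)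
    qed
  qed
  show ?thesis
    by (intro exI[of _ \<mu>] conjI ballI allI impI exI[of _ C1])
       (use fin \<mu>0 weak \<mu>_lip C1(1) in blast)+
qed

end

theorem theorem2p5:
  fixes V :: "'a::euclidean_space measure \<Rightarrow> ('a \<times> 'a) measure"
    and s :: "'a measure \<Rightarrow> 'a measure"
    and c :: "'a \<Rightarrow> 'a measure \<Rightarrow> real"
    and \<mu>0 :: "'a measure"
    and T :: real
  assumes V_fin: "\<And>\<mu>. fin_meas \<mu> \<Longrightarrow> fin_meas (V \<mu>)"
    and V_marg: "\<And>\<mu>. fin_meas \<mu> \<Longrightarrow> distr (V \<mu>) borel fst = \<mu>"
    and V1: "\<exists>CS>0. \<forall>\<mu>. fin_meas \<mu> \<longrightarrow> (\<forall>R. (\<forall>(x,v)\<in>supp (V \<mu>). norm x \<le> R) \<longrightarrow>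
              (\<forall>(x,v)\<in>supp (V \<mu>). norm v \<le> CS * (1 + R)))"
    and V2: "\<forall>R>0. \<exists>CF. \<forall>\<mu> \<nu>. fin_meas \<mu> \<and> fin_meas \<nu> \<and> supp \<mu> \<subseteq> cball 0 R \<and> supp \<nu> \<subseteq> cball 0 R
              \<longrightarrow> flat (V \<mu>) (V \<nu>) \<le> CF * flat \<mu> \<nu>"
    and S_fin: "\<And>\<mu>. fin_meas \<mu> \<Longrightarrow> fin_meas (s \<mu>)"
    and S1: "\<exists>L. \<forall>\<mu> \<nu>. fin_meas \<mu> \<and> fin_meas \<nu> \<longrightarrow> flat (s \<mu>) (s \<nu>) \<le> L * flat \<mu> \<nu>"
    and S2: "\<exists>R. \<forall>\<mu>. fin_meas \<mu> \<longrightarrow> supp (s \<mu>) \<subseteq> cball 0 R"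
    and C1: "\<exists>Cb>0. \<forall>x \<mu>. fin_meas \<mu> \<longrightarrow> \<bar>c x \<mu>\<bar> \<le> Cb"
    and C2: "\<exists>CL>0. \<forall>x y \<mu> \<nu>. fin_meas \<mu> \<and> fin_meas \<nu> \<longrightarrow>
              \<bar>c x \<mu> - c y \<nu>\<bar> \<le> CL * (norm (x - y) + flat \<mu> \<nu>)"
    and mu0: "fin_meas \<mu>0" "compact (supp \<mu>0)"
    and T: "0 < T"
  shows "\<exists>\<mu> :: real \<Rightarrow> 'a measure.
     (\<forall>t\<in>{0..T}. fin_meas (\<mu> t)) \<and> \<mu> 0 = \<mu>0 \<and>
     (\<forall>t\<in>{0..T}. \<forall>e>0. \<exists>\<delta>>0. \<forall>r\<in>{0..T}. \<bar>r - t\<bar> < \<delta> \<longrightarrow> flat (\<mu> r) (\<mu> t) < e) \<and>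
     (\<forall>f. Cc_inf f \<longrightarrow>
        (\<forall>r\<in>{0..T}. integrable (V (\<mu> r)) (\<lambda>(x,v). frechet_derivative f (at x) v)) \<and>
        (\<forall>t\<in>{0..T}.
          (\<lambda>r. \<integral>(x,v). frechet_derivative f (at x) v \<partial>V (\<mu> r)) integrable_on {0..t} \<and>
          (\<lambda>r. \<integral>x. f x * c x (\<mu> r) \<partial>\<mu> r) integrable_on {0..t} \<and>
          (\<lambda>r. \<integral>x. f x \<partial>s (\<mu> r)) integrable_on {0..t} \<and>
          (\<integral>x. f x \<partial>\<mu> t) - (\<integral>x. f x \<partial>\<mu>0) =
            integral {0..t} (\<lambda>r. \<integral>(x,v). frechet_derivative f (at x) v \<partial>V (\<mu> r))
          + integral {0..t} (\<lambda>r. \<integral>x. f x * c x (\<mu> r) \<partial>\<mu> r)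
          + integral {0..t} (\<lambda>r. \<integral>x. f x \<partial>s (\<mu> r)))) \<and>
     (\<exists>K. \<forall>t\<in>{0..T}. \<forall>r\<in>{0..T}. flat (\<mu> t) (\<mu> r) \<le> K * \<bar>t - r\<bar>)"
proof -
  obtain CS where CS: "CS > 0" "\<And>\<mu> R x v. fin_meas \<mu> \<Longrightarrow> \<forall>(x,v)\<in>supp (V \<mu>). norm x \<le> R \<Longrightarrow>
      (x, v) \<in> supp (V \<mu>) \<Longrightarrow> norm v \<le> CS * (1 + R)"
    using V1 by fastforce
  obtain L0 where L0: "\<And>\<mu> \<nu>. fin_meas \<mu> \<Longrightarrow> fin_meas \<nu> \<Longrightarrow> flat (s \<mu>) (s \<nu>) \<le> L0 * flat \<mu> \<nu>"
    using S1 by blast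
  obtain Rs where Rs: "\<And>\<mu>. fin_meas \<mu> \<Longrightarrow> supp (s \<mu>) \<subseteq> cball 0 Rs" using S2 by blast
  obtain Cb where Cb: "Cb > 0" "\<And>x \<mu>. fin_meas \<mu> \<Longrightarrow> \<bar>c x \<mu>\<bar> \<le> Cb" using C1 by blast
  obtain CL where CL: "CL > 0" "\<And>x y \<mu> \<nu>. fin_meas \<mu> \<Longrightarrow> fin_meas \<nu> \<Longrightarrow>
      \<bar>c x \<mu> - c y \<nu>\<bar> \<le> CL * (norm (x - y) + flat \<mu> \<nu>)" using C2 by blast
  \<comment> \<open>Lipschitz constants of unspecified sign may be replaced by nonnegative ones
    because \<open>flat\<close> is nonnegative.\<close>
  have enlarge: "a * flat M N \<le> max a 0 * flat M N" if "fin_meas M" "fin_meas N" for a and M N :: "'a measure"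
    using flat_nonneg[OF that] by (intro mult_right_mono) auto
  interpret mde V s c \<mu>0 CS "max L0 0" Rs Cb CL
  proof (standard, goal_cases)
    \<comment> \<open>Goals 5 and 8 are (V2) and (S1), the two whose constants are enlarged.\<close>
    case (5 R)
    obtain CF where CF: "\<forall>\<mu> \<nu>. fin_meas \<mu> \<and> fin_meas \<nu> \<and> supp \<mu> \<subseteq> cball 0 R \<and> supp \<nu> \<subseteq> cball 0 R
        \<longrightarrow> flat (V \<mu>) (V \<nu>) \<le> CF * flat \<mu> \<nu>"
      using V2 5 by blast
    show ?case
    proof (intro exI[of _ "max CF 0"] conjI allI impI)
      fix \<mu> \<nu> :: "'a measure"
      assume "fin_meas \<mu> \<and> fin_meas \<nu> \<and> supp \<mu> \<subseteq> cball 0 R \<and> supp \<nu> \<subseteq> cball 0 R"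
      then show "flat (V \<mu>) (V \<nu>) \<le> max CF 0 * flat \<mu> \<nu>"
        using CF enlarge[of \<mu> \<nu> CF] by (meson order_trans)
    qed simp
  next
    case (8 \<mu> \<nu>)
    then show ?case using L0 enlarge order_trans by blast
  qed (use V_fin V_marg CS S_fin Rs Cb CL mu0 in auto)
  obtain \<mu> K where \<mu>: "\<forall>t\<in>{0..T}. fin_meas (\<mu> t)" "\<mu> 0 = \<mu>0"
    and weak: "\<forall>f. Cc_inf f \<longrightarrow>
        (\<forall>r\<in>{0..T}. integrable (V (\<mu> r)) (\<lambda>(x,v). frechet_derivative f (at x) v)) \<and>
        (\<forall>t\<in>{0..T}.
          (\<lambda>r. drift f (\<mu> r)) integrable_on {0..t} \<and>
          (\<lambda>r. growth f (\<mu> r)) integrable_on {0..t} \<and>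
          (\<lambda>r. source f (\<mu> r)) integrable_on {0..t} \<and>
          (\<integral>x. f x \<partial>\<mu> t) - (\<integral>x. f x \<partial>\<mu>0) =
            integral {0..t} (\<lambda>r. drift f (\<mu> r))
          + integral {0..t} (\<lambda>r. growth f (\<mu> r))
          + integral {0..t} (\<lambda>r. source f (\<mu> r)))"
    and K: "K \<ge> 0" "\<forall>t\<in>{0..T}. \<forall>r\<in>{0..T}. flat (\<mu> t) (\<mu> r) \<le> K * \<bar>t - r\<bar>"
    using solution_exists[OF \<open>compact (supp \<mu>0)\<close> T] by blast
  have cont: "\<exists>\<delta>>0. \<forall>r\<in>{0..T}. \<bar>r - t\<bar> < \<delta> \<longrightarrow> flat (\<mu> r) (\<mu> t) < e" if t: "t \<in> {0..T}" and e: "e > 0" for t e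
  \<comment> \<open>\<open>K + 1\<close> avoids dividing by zero when the curve is constant.\<close>
  proof (intro exI[of _ "e / (K + 1)"] conjI ballI impI)
    show "0 < e / (K + 1)" using e K by simp
    fix r assume r: "r \<in> {0..T}" "\<bar>r - t\<bar> < e / (K + 1)"
    have "flat (\<mu> r) (\<mu> t) \<le> K * \<bar>r - t\<bar>" using K(2) r t by blast
    also have "\<dots> \<le> (K + 1) * \<bar>r - t\<bar>" by (simp add: distrib_right)
    also have "\<dots> < e" using r(2) K(1) by (simp add: pos_less_divide_eq mult.commute)
    finally show "flat (\<mu> r) (\<mu> t) < e" .
  qed
  show ?thesis
    by (rule exI[of _ \<mu>], intro conjI \<mu> ballI allI impI cont exI[of _ K])
       (use weak K(2) in \<open>auto simp: drift_def growth_def source_def\<close>)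
qed

end
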